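(* Let $\Gamma$ be a finite mixed graph and let $T(\Gamma)$ be the twisted right-angled Artin group based on $\Gamma$. Then the conjugacy problem in $T(\Gamma)$ is decidable: there is an algorithm which, given two words $u,v$ over $V\Gamma\sqcup V\Gamma^{-1}$, decides whether $u$ and $v$ represent conjugate elements of $T(\Gamma)$.
   Context: A mixed graph $\Gamma=(V,E,D,o,t)$ consists of a simplicial graph $(V,E)$ (no loops, no multiple edges; $E$ is a set of 2-element subsets of the non-empty set $V=V\Gamma$), a subset $D\subseteq E$ of directed edges, and maps $o,t\colon D\to V$ with $\{o(e),t(e)\}=e$ for every $e\in D$. Write $[a,b]$ for an undirected edge $\{a,b\}\in E\setminus D$ and $[a,b\rangle$ for a directed edge with origin $a$ and terminus $b$. The twisted right-angled Artin group (T-RAAG) based on a finite mixed graph $\Gamma$ is $$T(\Gamma)=\langle V \mid ab=ba \text{ if } [a,b]\in E,\ \ aba=b \text{ if } [a,b\rangle\in E\rangle .$$ *)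

theory Defs
  imports "HOL-Algebra.Group" "HOL-Library.Nat_Bijection"
begin

section \<open>General recursive functions\<close>

text \<open>Total recursive functions of several arguments, as functions on argument lists.
  \<open>recursive n f\<close> only concerns the values of \<open>f\<close> on lists of length \<open>n\<close>; the values on
  other lists are junk and are never used. Minimization is restricted to regular functions
  (those for which a zero always exists), so that only total functions arise.\<close>

inductive recursive :: "nat \<Rightarrow> (nat list \<Rightarrow> nat) \<Rightarrow> bool" where
  rec_zero: "recursive n (\<lambda>xs. 0)"
| rec_succ: "recursive 1 (\<lambda>xs. Suc (xs ! 0))"
| rec_proj: "i < n \<Longrightarrow> recursive n (\<lambda>xs. xs ! i)"
| rec_comp: "recursive (length gs) f \<Longrightarrow> (\<forall>g\<in>set gs. recursive n g)
    \<Longrightarrow> recursive n (\<lambda>xs. f (map (\<lambda>g. g xs) gs))"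
| rec_prim: "recursive n f \<Longrightarrow> recursive (Suc (Suc n)) g
    \<Longrightarrow> recursive (Suc n)
          (\<lambda>xs. rec_nat (f (tl xs)) (\<lambda>k r. g (k # r # tl xs)) (hd xs))"
| rec_mini: "recursive (Suc n) f \<Longrightarrow> (\<forall>xs. length xs = n \<longrightarrow> (\<exists>y. f (y # xs) = 0))
    \<Longrightarrow> recursive n (\<lambda>xs. LEAST y. f (y # xs) = 0)"

text \<open>A binary relation on words over a finite alphabet \<open>A\<close> is decidable if its characteristic
  function is recursive on codes of words, whatever numbering \<open>c\<close> of the letters is chosen.\<close>

definition decidable_word_rel :: "'a set \<Rightarrow> ('a list \<Rightarrow> 'a list \<Rightarrow> bool) \<Rightarrow> bool" where
  "decidable_word_rel A P \<longleftrightarrow> finite A \<and>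
     (\<forall>c :: 'a \<Rightarrow> nat. inj_on c A \<longrightarrow>
       (\<exists>f. recursive 2 f \<and>
         (\<forall>u \<in> lists A. \<forall>v \<in> lists A.
            f [list_encode (map c u), list_encode (map c v)] = (if P u v then 1 else 0))))"

section \<open>Groups given by generators and relations\<close>

text \<open>The letter \<open>(a, True)\<close> stands for the generator \<open>a\<close> and \<open>(a, False)\<close> for its formal
  inverse.\<close>

type_synonym 'a letter = "'a \<times> bool"

definition letters :: "'a set \<Rightarrow> 'a letter set" where
  "letters S = S \<times> UNIV"

text \<open>The congruence on words generated by free cancellation and by the relations \<open>l = r\<close>
  with \<open>(l, r) \<in> R\<close>.\<close>

inductive_set pres_eq :: "'a set \<Rightarrow> ('a letter list \<times> 'a letter list) set
    \<Rightarrow> ('a letter list \<times> 'a letter list) set"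
  for S :: "'a set" and R :: "('a letter list \<times> 'a letter list) set" where
  pres_cancel: "a \<in> S \<Longrightarrow> ([(a, e), (a, \<not> e)], []) \<in> pres_eq S R"
| pres_rel: "(l, r) \<in> R \<Longrightarrow> (l, r) \<in> pres_eq S R"
| pres_refl: "w \<in> lists (letters S) \<Longrightarrow> (w, w) \<in> pres_eq S R"
| pres_sym: "(u, v) \<in> pres_eq S R \<Longrightarrow> (v, u) \<in> pres_eq S R"
| pres_trans: "(u, v) \<in> pres_eq S R \<Longrightarrow> (v, w) \<in> pres_eq S R \<Longrightarrow> (u, w) \<in> pres_eq S R"
| pres_context: "(u, v) \<in> pres_eq S R \<Longrightarrow> p \<in> lists (letters S) \<Longrightarrow> q \<in> lists (letters S)
    \<Longrightarrow> (p @ u @ q, p @ v @ q) \<in> pres_eq S R"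

definition word_class :: "'a set \<Rightarrow> ('a letter list \<times> 'a letter list) set
    \<Rightarrow> 'a letter list \<Rightarrow> 'a letter list set" where
  "word_class S R w = pres_eq S R `` {w}"

definition presented_group :: "'a set \<Rightarrow> ('a letter list \<times> 'a letter list) set
    \<Rightarrow> 'a letter list set monoid" where
  "presented_group S R =
     \<lparr>carrier = lists (letters S) // pres_eq S R,
      monoid.mult = (\<lambda>X Y. \<Union>x\<in>X. \<Union>y\<in>Y. word_class S R (x @ y)),
      one = word_class S R []\<rparr>"

lemma pres_eq_words:
  assumes R: "R \<subseteq> lists (letters S) \<times> lists (letters S)" and "(u, v) \<in> pres_eq S R"
  shows "u \<in> lists (letters S) \<and> v \<in> lists (letters S)"
  using assms(2) by induction (use R in \<open>auto simp: letters_def\<close>)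

lemma equiv_pres_eq:
  assumes "R \<subseteq> lists (letters S) \<times> lists (letters S)"
  shows "equiv (lists (letters S)) (pres_eq S R)"
proof (rule equivI)
  show "pres_eq S R \<subseteq> lists (letters S) \<times> lists (letters S)"
    using pres_eq_words[OF assms] by auto
  show "refl_on (lists (letters S)) (pres_eq S R)"
    by (auto simp: refl_on_def intro: pres_refl)
  show "sym (pres_eq S R)" by (auto simp: sym_def intro: pres_sym)
  show "trans (pres_eq S R)" by (auto simp: trans_def intro: pres_trans)
qed

lemma pres_eq_append:
  assumes R: "R \<subseteq> lists (letters S) \<times> lists (letters S)"
    and 1: "(u, u') \<in> pres_eq S R" and 2: "(v, v') \<in> pres_eq S R"
  shows "(u @ v, u' @ v') \<in> pres_eq S R"
proof -
  have "(u @ v, u' @ v) \<in> pres_eq S R"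
    using pres_context[OF 1, of "[]" v] pres_eq_words[OF R 2] by simp
  moreover have "(u' @ v, u' @ v') \<in> pres_eq S R"
    using pres_context[OF 2, of u' "[]"] pres_eq_words[OF R 1] by simp
  ultimately show ?thesis by (rule pres_trans)
qed

lemma word_class_mult:
  assumes R: "R \<subseteq> lists (letters S) \<times> lists (letters S)"
    and u: "u \<in> lists (letters S)" and v: "v \<in> lists (letters S)"
  shows "word_class S R u \<otimes>\<^bsub>presented_group S R\<^esub> word_class S R v = word_class S R (u @ v)"
proof -
  have *: "word_class S R (x @ y) = word_class S R (u @ v)"
    if "x \<in> word_class S R u" "y \<in> word_class S R v" for x y
  proof -
    have "(u @ v, x @ y) \<in> pres_eq S R"
      using that by (intro pres_eq_append[OF R]) (auto simp: word_class_def)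
    from equiv_class_eq[OF equiv_pres_eq[OF R] this] show ?thesis
      by (simp add: word_class_def)
  qed
  have mem: "u \<in> word_class S R u" "v \<in> word_class S R v"
    using u v by (auto simp: word_class_def intro: pres_refl)
  have "word_class S R u \<otimes>\<^bsub>presented_group S R\<^esub> word_class S R v
      = (\<Union>x\<in>word_class S R u. \<Union>y\<in>word_class S R v. word_class S R (x @ y))"
    by (simp add: presented_group_def)
  also have "\<dots> = (\<Union>x\<in>word_class S R u. \<Union>y\<in>word_class S R v. word_class S R (u @ v))"
    by (intro SUP_cong refl *)
  also have "\<dots> = word_class S R (u @ v)"
    using mem by auto
  finally show ?thesis .
qed

lemma word_class_carrier:
  "w \<in> lists (letters S) \<Longrightarrow> word_class S R w \<in> carrier (presented_group S R)"
  by (auto simp: presented_group_def word_class_def quotient_def)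

lemma presented_group_cases:
  assumes "x \<in> carrier (presented_group S R)"
  obtains w where "w \<in> lists (letters S)" "x = word_class S R w"
  using assms by (auto simp: presented_group_def word_class_def quotient_def)

lemma word_inverse:
  assumes R: "R \<subseteq> lists (letters S) \<times> lists (letters S)" and "w \<in> lists (letters S)"
  shows "\<exists>w' \<in> lists (letters S). (w' @ w, []) \<in> pres_eq S R"
  using assms(2)
proof induction
  case Nil
  then show ?case by (auto intro: pres_refl)
next
  case (Cons x w)
  then obtain w' where w': "w' \<in> lists (letters S)" "(w' @ w, []) \<in> pres_eq S R" by auto
  obtain a e where x: "x = (a, e)" "a \<in> S" using Cons by (auto simp: letters_def)
  have "([(a, \<not> e), (a, \<not> \<not> e)], []) \<in> pres_eq S R" using x by (intro pres_cancel)
  from pres_context[OF this w'(1), of w]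
  have "((w' @ [(a, \<not> e)]) @ x # w, w' @ w) \<in> pres_eq S R" using Cons x by simp
  then have "((w' @ [(a, \<not> e)]) @ x # w, []) \<in> pres_eq S R" using w'(2) by (rule pres_trans)
  then show ?case using w' x by (intro bexI[of _ "w' @ [(a, \<not> e)]"]) (auto simp: letters_def)
qed

lemma group_presented_group:
  assumes R: "R \<subseteq> lists (letters S) \<times> lists (letters S)"
  shows "group (presented_group S R)"
proof (rule groupI)
  let ?G = "presented_group S R"
  have one: "\<one>\<^bsub>?G\<^esub> = word_class S R []" by (simp add: presented_group_def)
  show "\<one>\<^bsub>?G\<^esub> \<in> carrier ?G" using word_class_carrier[of "[]" S R] one by simp
  fix x assume "x \<in> carrier ?G"
  then obtain u where u: "u \<in> lists (letters S)" "x = word_class S R u"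
    by (rule presented_group_cases)
  show "\<one>\<^bsub>?G\<^esub> \<otimes>\<^bsub>?G\<^esub> x = x"
    using word_class_mult[OF R, of "[]" u] u one by simp
  obtain u' where u': "u' \<in> lists (letters S)" "(u' @ u, []) \<in> pres_eq S R"
    using word_inverse[OF R u(1)] by blast
  have "word_class S R (u' @ u) = word_class S R []"
    unfolding word_class_def using equiv_class_eq[OF equiv_pres_eq[OF R] u'(2)] .
  then show "\<exists>y\<in>carrier ?G. y \<otimes>\<^bsub>?G\<^esub> x = \<one>\<^bsub>?G\<^esub>"
    using word_class_mult[OF R u'(1) u(1)] one u(2)
    by (intro bexI[of _ "word_class S R u'"] word_class_carrier[OF u'(1)]) simp
  fix y assume "y \<in> carrier ?G"
  then obtain v where v: "v \<in> lists (letters S)" "y = word_class S R v"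
    by (rule presented_group_cases)
  show "x \<otimes>\<^bsub>?G\<^esub> y \<in> carrier ?G"
    using u v word_class_mult[OF R u(1) v(1)] word_class_carrier[of "u @ v" S R] by simp
  fix z assume "z \<in> carrier ?G"
  then obtain w where w: "w \<in> lists (letters S)" "z = word_class S R w"
    by (rule presented_group_cases)
  show "x \<otimes>\<^bsub>?G\<^esub> y \<otimes>\<^bsub>?G\<^esub> z = x \<otimes>\<^bsub>?G\<^esub> (y \<otimes>\<^bsub>?G\<^esub> z)"
    using u v w by (simp add: word_class_mult[OF R])
qed

definition conjugate_in :: "('a, 'b) monoid_scheme \<Rightarrow> 'a \<Rightarrow> 'a \<Rightarrow> bool" where
  "conjugate_in G x y \<longleftrightarrow> (\<exists>g \<in> carrier G. y = g \<otimes>\<^bsub>G\<^esub> x \<otimes>\<^bsub>G\<^esub> inv\<^bsub>G\<^esub> g)"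

section \<open>Mixed graphs and twisted right-angled Artin groups\<close>

record 'v mixed_graph =
  verts :: "'v set"
  edges :: "'v set set"
  dir_edges :: "'v set set"
  origin :: "'v set \<Rightarrow> 'v"
  terminus :: "'v set \<Rightarrow> 'v"

definition mixed_graph :: "'v mixed_graph \<Rightarrow> bool" where
  "mixed_graph \<Gamma> \<longleftrightarrow>
     verts \<Gamma> \<noteq> {} \<and>
     (\<forall>e \<in> edges \<Gamma>. e \<subseteq> verts \<Gamma> \<and> card e = 2) \<and>
     dir_edges \<Gamma> \<subseteq> edges \<Gamma> \<and>
     (\<forall>e \<in> dir_edges \<Gamma>. {origin \<Gamma> e, terminus \<Gamma> e} = e)"

definition finite_mixed_graph :: "'v mixed_graph \<Rightarrow> bool" where
  "finite_mixed_graph \<Gamma> \<longleftrightarrow> mixed_graph \<Gamma> \<and> finite (verts \<Gamma>)"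

abbreviation (input) pos :: "'a \<Rightarrow> 'a letter" where
  "pos a \<equiv> (a, True)"

definition traag_rels :: "'v mixed_graph \<Rightarrow> ('v letter list \<times> 'v letter list) set" where
  "traag_rels \<Gamma> =
     {([pos a, pos b], [pos b, pos a]) | a b. {a, b} \<in> edges \<Gamma> - dir_edges \<Gamma>} \<union>
     {([pos a, pos b, pos a], [pos b]) | a b.
        \<exists>e \<in> dir_edges \<Gamma>. origin \<Gamma> e = a \<and> terminus \<Gamma> e = b}"

definition traag :: "'v mixed_graph \<Rightarrow> 'v letter list set monoid" where
  "traag \<Gamma> = presented_group (verts \<Gamma>) (traag_rels \<Gamma>)"

definition traag_elem :: "'v mixed_graph \<Rightarrow> 'v letter list \<Rightarrow> 'v letter list set" where
  "traag_elem \<Gamma> w = word_class (verts \<Gamma>) (traag_rels \<Gamma>) w"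

lemma traag_rels_words:
  assumes "mixed_graph \<Gamma>"
  shows "traag_rels \<Gamma> \<subseteq> lists (letters (verts \<Gamma>)) \<times> lists (letters (verts \<Gamma>))"
proof -
  have "a \<in> verts \<Gamma> \<and> b \<in> verts \<Gamma>" if "{a, b} \<in> edges \<Gamma>" for a b
    using that assms by (auto simp: mixed_graph_def)
  moreover have "{origin \<Gamma> e, terminus \<Gamma> e} \<in> edges \<Gamma>" if "e \<in> dir_edges \<Gamma>" for e
    using that assms by (auto simp: mixed_graph_def)
  ultimately show ?thesis
    unfolding traag_rels_def letters_def by fastforce
qed

lemma group_traag: "mixed_graph \<Gamma> \<Longrightarrow> group (traag \<Gamma>)"
  unfolding traag_def by (intro group_presented_group traag_rels_words)

lemma traag_elem_carrier:
  "w \<in> lists (letters (verts \<Gamma>)) \<Longrightarrow> traag_elem \<Gamma> w \<in> carrier (traag \<Gamma>)"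
  unfolding traag_def traag_elem_def by (rule word_class_carrier)

end

theory Submission
  imports Defs
begin

text \<open>Conjugacy is studied on cyclic words. A letter can be moved past a letter on an adjacent
  vertex at the cost of possibly inverting one of the two. Besides these swaps, rotations and
  cancellations, one more length-preserving move is needed: if all letters of \<open>w\<close> are on vertices
  adjacent to \<open>a\<close> and \<open>a\<close> moves around \<open>w\<close> unchanged, \<open>w\<close> is replaced by its conjugate by \<open>a\<close>.
  Modulo the length-preserving moves cancellation is confluent: a pair that is about to cancel can
  be traced through any sequence of such moves, and the word without this pair follows along. Hence
  conjugate words have a common descendant, so they are linked by moves through words whose length
  exceeds the sum of the two lengths by at most two. These are finitely many words, and the search
  can be carried out by a recursive function.\<close>

section \<open>Closure properties of recursive functions\<close>

text \<open>The extra move answers an obstacle peculiar to cyclic words: two letters on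
  \<open>a\<close> that together with \<open>w\<close> form the whole word may cancel across the
  empty arc or around \<open>w\<close>, and the results \<open>w\<close> and \<open>flip a w\<close>
  need not be linked by the other moves. For adjacent \<open>a\<close> and \<open>b\<close> with
  \<open>tw a b\<close> and not \<open>tw b a\<close>, the letter \<open>b\<close> and its inverse
  are conjugate by \<open>a\<close>, yet swaps, rotations and cancellations leave a one-letter word
  unchanged. Since length-preserving moves can be undone, rewriting does not terminate, and the goal
  is confluence modulo the equivalence that they generate. This requires joining two cancellations
  separated by arbitrarily many moves, hence the tracing of a pair. In the search itself the extra
  move is imitated by inserting a pair on \<open>a\<close> and carrying one of its letters around
  the word, which costs the two additional letters.\<close>

text \<open>\<open>recursive\<close> fixes a function on all lists, also on those of the wrong
  length. Agreement on \<open>n\<close>-tuples is what survives rewriting of terms.\<close>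

definition computable :: "nat \<Rightarrow> (nat list \<Rightarrow> nat) \<Rightarrow> bool" where
  "computable n f \<longleftrightarrow> (\<exists>g. recursive n g \<and> (\<forall>xs. length xs = n \<longrightarrow> g xs = f xs))"

lemma computable_cong:
  assumes "computable n f" "\<And>xs. length xs = n \<Longrightarrow> f xs = g xs"
  shows "computable n g"
  using assms unfolding computable_def by metis

lemma computable_zero: "computable n (\<lambda>xs. 0)"
  unfolding computable_def using rec_zero by blast

lemma computable_nth: "i < n \<Longrightarrow> computable n (\<lambda>xs. xs ! i)"
  unfolding computable_def using rec_proj by blast

lemma computable_comp:
  assumes "computable (length gs) f" "\<forall>g\<in>set gs. computable n g"
  shows "computable n (\<lambda>xs. f (map (\<lambda>g. g xs) gs))"
proof -
  from assms(1) obtain f' where f': "recursive (length gs) f'"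
    "\<And>xs. length xs = length gs \<Longrightarrow> f' xs = f xs"
    unfolding computable_def by auto
  from assms(2) obtain G where G: "\<forall>g\<in>set gs. recursive n (G g)"
    "\<And>g xs. g \<in> set gs \<Longrightarrow> length xs = n \<Longrightarrow> G g xs = g xs"
    unfolding computable_def by metis
  have "recursive n (\<lambda>xs. f' (map (\<lambda>g. g xs) (map G gs)))"
    using f'(1) G(1) by (intro rec_comp) auto
  moreover have "f' (map (\<lambda>g. g xs) (map G gs)) = f (map (\<lambda>g. g xs) gs)" if "length xs = n" for xs
    using G(2)[OF _ that] by (subst f'(2)) (auto intro!: arg_cong[of _ _ f])
  ultimately show ?thesis unfolding computable_def by blast
qed

lemma computable_subst1:
  assumes "computable 1 (\<lambda>xs. h (xs ! 0))" "computable n f"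
  shows "computable n (\<lambda>xs. h (f xs))"
  using computable_comp[of "[f]" "\<lambda>xs. h (xs ! 0)" n] assms by simp

lemma computable_subst2:
  assumes "computable 2 (\<lambda>xs. h (xs ! 0) (xs ! 1))" "computable n f" "computable n g"
  shows "computable n (\<lambda>xs. h (f xs) (g xs))"
  using computable_comp[of "[f, g]" "\<lambda>xs. h (xs ! 0) (xs ! 1)" n] assms by (simp add: numeral_2_eq_2)

lemma computable_Suc: "computable n f \<Longrightarrow> computable n (\<lambda>xs. Suc (f xs))"
  using computable_subst1[of Suc] rec_succ unfolding computable_def by blast

lemma computable_const: "computable n (\<lambda>xs. c)"
  by (induction c) (auto intro: computable_zero computable_Suc)

lemma computable_weaken:
  assumes "computable n f" shows "computable (Suc n) (\<lambda>xs. f (tl xs))"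
proof -
  have "computable (Suc n) (\<lambda>xs. f (map (\<lambda>g. g xs) (map (\<lambda>i xs. xs ! Suc i) [0..<n])))"
    using assms by (intro computable_comp) (auto intro!: computable_nth)
  then show ?thesis
    by (rule computable_cong)
      (auto intro!: arg_cong[of _ _ f] nth_equalityI simp: nth_tl)
qed

text \<open>Minimization puts one bound variable in front of the arguments and recursion puts two,
  so inside such terms the original arguments are read under one, two or three
  \<open>tl\<close>.\<close>

lemma computable_nth_tl_tl: "Suc (Suc i) < n \<Longrightarrow> computable n (\<lambda>xs. tl (tl xs) ! i)"
  by (rule computable_cong[OF computable_nth[of "Suc (Suc i)"]]) (auto simp: nth_tl)

lemma computable_nth_tl: "Suc i < n \<Longrightarrow> computable n (\<lambda>xs. tl xs ! i)"
  by (rule computable_cong[OF computable_nth[of "Suc i"]]) (auto simp: nth_tl)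

lemma computable_nth_tl_tl_tl:
  "Suc (Suc (Suc i)) < n \<Longrightarrow> computable n (\<lambda>xs. tl (tl (tl xs)) ! i)"
  by (rule computable_cong[OF computable_nth[of "Suc (Suc (Suc i))"]]) (auto simp: nth_tl)

lemma computable_rec_nat:
  assumes a: "computable n a" and m: "computable n m"
    and h: "computable (Suc (Suc n)) (\<lambda>ys. h (ys ! 0) (ys ! 1) (tl (tl ys)))"
  shows "computable n (\<lambda>xs. rec_nat (a xs) (\<lambda>k r. h k r xs) (m xs))"
proof -
  from a obtain a' where a': "recursive n a'" "\<And>xs. length xs = n \<Longrightarrow> a' xs = a xs"
    unfolding computable_def by auto
  from h obtain h' where h': "recursive (Suc (Suc n)) h'"
    "\<And>ys. length ys = Suc (Suc n) \<Longrightarrow> h' ys = h (ys ! 0) (ys ! 1) (tl (tl ys))"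
    unfolding computable_def by auto
  define F where "F = (\<lambda>zs. rec_nat (a' (tl zs)) (\<lambda>k r. h' (k # r # tl zs)) (hd zs))"
  have "computable (Suc n) F"
    unfolding computable_def F_def using rec_prim[OF a'(1) h'(1)] by blast
  \<comment> \<open>The counter of \<open>rec_prim\<close> is the head of the list, so
    \<open>F\<close> has to be fed with \<open>m xs # xs\<close>.\<close>
  then have "computable n (\<lambda>xs. F (map (\<lambda>g. g xs) (m # map (\<lambda>i xs. xs ! i) [0..<n])))"
    using m by (intro computable_comp) (auto intro!: computable_nth)
  then show ?thesis
  proof (rule computable_cong)
    fix xs :: "nat list" assume xs: "length xs = n"
    have "map (\<lambda>g. g xs) (m # map (\<lambda>i xs. xs ! i) [0..<n]) = m xs # xs"
      using xs by (auto intro!: nth_equalityI)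
    then show "F (map (\<lambda>g. g xs) (m # map (\<lambda>i xs. xs ! i) [0..<n]))
        = rec_nat (a xs) (\<lambda>k r. h k r xs) (m xs)"
      using xs a' h' by (simp add: F_def)
  qed
qed

lemma computable_Least:
  assumes h: "computable (Suc n) (\<lambda>ys. h (ys ! 0) (tl ys))"
    and ex: "\<And>xs. length xs = n \<Longrightarrow> \<exists>y. h y xs = 0"
  shows "computable n (\<lambda>xs. LEAST y. h y xs = 0)"
proof -
  from h obtain h' where h': "recursive (Suc n) h'"
    "\<And>ys. length ys = Suc n \<Longrightarrow> h' ys = h (ys ! 0) (tl ys)"
    unfolding computable_def by auto
  have "recursive n (\<lambda>xs. LEAST y. h' (y # xs) = 0)"
    using ex h' by (intro rec_mini) auto
  then show ?thesis using h' unfolding computable_def by force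
qed

named_theorems computable_intros

lemmas [computable_intros] = computable_nth computable_nth_tl_tl_tl computable_nth_tl_tl computable_nth_tl
  computable_Suc computable_const

section \<open>Arithmetic, case distinction and bounded search\<close>

lemma computable_add [computable_intros]:
  assumes "computable n f" "computable n g"
  shows "computable n (\<lambda>xs. f xs + g xs)"
proof -
  have "rec_nat x (\<lambda>k r. Suc r) y = x + y" for x y by (induction y) auto
  then show ?thesis
    using computable_rec_nat[of n f g "\<lambda>k r xs. Suc r"] assms
    by (simp add: computable_intros)
qed

lemma computable_mult [computable_intros]:
  assumes "computable n f" "computable n g"
  shows "computable n (\<lambda>xs. f xs * g xs)"
proof -
  have "rec_nat 0 (\<lambda>k r. x + r) y = x * y" for x y by (induction y) auto
  moreover have "computable 2 (\<lambda>xs. rec_nat 0 (\<lambda>k r. xs ! 0 + r) (xs ! 1))"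
    by (intro computable_rec_nat computable_intros) auto
  ultimately have "computable 2 (\<lambda>xs. xs ! 0 * xs ! 1)" by simp
  then show ?thesis using assms by (rule computable_subst2)
qed

lemma computable_diff [computable_intros]:
  assumes "computable n f" "computable n g"
  shows "computable n (\<lambda>xs. f xs - g xs)"
proof -
  have "rec_nat 0 (\<lambda>k r. k) y = y - 1" for y by (induction y) auto
  moreover have "computable 1 (\<lambda>xs. rec_nat 0 (\<lambda>k r. k) (xs ! 0))"
    by (intro computable_rec_nat computable_intros) auto
  ultimately have p: "computable 1 (\<lambda>xs. xs ! 0 - 1)" by simp
  have "rec_nat x (\<lambda>k r. r - 1) y = x - y" for x y by (induction y) auto
  moreover have "computable 2 (\<lambda>xs. rec_nat (xs ! 0) (\<lambda>k r. r - 1) (xs ! 1))"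
    by (intro computable_rec_nat computable_subst1[OF p] computable_intros) auto
  ultimately have "computable 2 (\<lambda>xs. xs ! 0 - xs ! 1)" by simp
  then show ?thesis using assms by (rule computable_subst2)
qed

text \<open>Truncated subtraction in both directions yields the distance, which is 0 exactly for
  equal numbers; a recursion that ignores its previous value is then a case distinction.\<close>

lemma computable_if_eq [computable_intros]:
  assumes "computable n f" "computable n g" "computable n s" "computable n t"
  shows "computable n (\<lambda>xs. if f xs = g xs then s xs else t xs)"
proof -
  have "rec_nat a (\<lambda>k r. b) ((x - y) + (y - x)) = (if x = y then a else b)" for a b x y :: nat
    by (cases "(x - y) + (y - x)") auto
  moreover have "computable n (\<lambda>xs. rec_nat (s xs) (\<lambda>k r. t xs) ((f xs - g xs) + (g xs - f xs)))"
    by (intro computable_rec_nat computable_intros computable_weaken assms)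
  ultimately show ?thesis by simp
qed

lemma rec_nat_bex:
  "rec_nat (0::nat) (\<lambda>k r. if P k then 1 else r) n = (if \<exists>k<n. P k then 1 else 0)"
  by (induction n) (auto simp: less_Suc_eq)

lemma computable_bex:
  assumes "computable (Suc (Suc n)) (\<lambda>ys. f (ys ! 0) (tl (tl ys)))"
    "computable (Suc (Suc n)) (\<lambda>ys. g (ys ! 0) (tl (tl ys)))" "computable n m"
  shows "computable n (\<lambda>xs. if \<exists>k<m xs. f k xs = g k xs then 1 else 0)"
proof -
  have "computable n (\<lambda>xs. rec_nat 0 (\<lambda>k r. if f k xs = g k xs then 1 else r) (m xs))"
    using assms by (intro computable_rec_nat computable_intros) auto
  then show ?thesis by (simp only: rec_nat_bex)
qed

section \<open>Computing with codes of pairs and lists\<close>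

lemma computable_prod_encode [computable_intros]:
  assumes "computable n f" "computable n g"
  shows "computable n (\<lambda>xs. prod_encode (f xs, g xs))"
proof -
  have "rec_nat 0 (\<lambda>k r. r + Suc k) y = triangle y" for y by (induction y) auto
  moreover have "computable 1 (\<lambda>xs. rec_nat 0 (\<lambda>k r. r + Suc k) (xs ! 0))"
    by (intro computable_rec_nat computable_intros) auto
  ultimately have p: "computable 1 (\<lambda>xs. triangle (xs ! 0))" by simp
  show ?thesis unfolding prod_encode_def
    using assms by (auto intro!: computable_subst1[OF p] computable_intros)
qed

text \<open>One component is found by minimization, while the other is bounded by the code itself.
  Subtracting the indicator from 1 makes a hit the zero that minimization looks for.\<close>

lemma computable_prod_decode:
  "computable 1 (\<lambda>xs. fst (prod_decode (xs ! 0)))"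
  "computable 1 (\<lambda>xs. snd (prod_decode (xs ! 0)))"
proof -
  have ex: "(\<exists>y<Suc p. prod_encode (x, y) = p) \<longleftrightarrow> x = fst (prod_decode p)"
           "(\<exists>y<Suc p. prod_encode (y, x) = p) \<longleftrightarrow> x = snd (prod_decode p)" for x p
  proof -
    obtain a b where p: "p = prod_encode (a, b)" by (metis prod.collapse prod_decode_inverse)
    show "(\<exists>y<Suc p. prod_encode (x, y) = p) \<longleftrightarrow> x = fst (prod_decode p)"
      "(\<exists>y<Suc p. prod_encode (y, x) = p) \<longleftrightarrow> x = snd (prod_decode p)"
      unfolding p using le_prod_encode_1[of a b] le_prod_encode_2[of b a]
      by (auto simp: less_Suc_eq_le)
  qed
  have "computable 1 (\<lambda>xs. LEAST x. (1::nat) - (if \<exists>y<Suc (xs ! 0). prod_encode (x, y) = xs ! 0 then 1 else 0) = 0)"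
    by (rule computable_Least, intro computable_intros computable_bex) (auto simp: ex)
  then show "computable 1 (\<lambda>xs. fst (prod_decode (xs ! 0)))"
    unfolding ex by (rule computable_cong) (auto intro!: Least_equality split: if_splits)
  have "computable 1 (\<lambda>xs. LEAST x. (1::nat) - (if \<exists>y<Suc (xs ! 0). prod_encode (y, x) = xs ! 0 then 1 else 0) = 0)"
    by (rule computable_Least, intro computable_intros computable_bex) (auto simp: ex)
  then show "computable 1 (\<lambda>xs. snd (prod_decode (xs ! 0)))"
    unfolding ex by (rule computable_cong) (auto intro!: Least_equality split: if_splits)
qed

lemmas [computable_intros] =
  computable_subst1[OF computable_prod_decode(1)] computable_subst1[OF computable_prod_decode(2)]

lemma prod_decode_0: "prod_decode 0 = (0, 0)"
  using prod_encode_inverse[of "(0, 0)"] by (simp add: prod_encode_def)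

text \<open>On the code \<open>0\<close> of the empty list both functions return \<open>0\<close>.\<close>

definition hd_code :: "nat \<Rightarrow> nat" where "hd_code w = fst (prod_decode (w - 1))"
definition tl_code :: "nat \<Rightarrow> nat" where "tl_code w = snd (prod_decode (w - 1))"

lemma hd_code_Cons [simp]: "hd_code (Suc (prod_encode (x, w))) = x"
  by (simp add: hd_code_def)

lemma tl_code_list_encode [simp]: "tl_code (list_encode xs) = list_encode (tl xs)"
  by (cases xs) (simp_all add: tl_code_def prod_decode_0)

lemma hd_code_0 [simp]: "hd_code 0 = 0"
  by (simp add: hd_code_def prod_decode_0)

lemma funpow_tl_code [simp]: "(tl_code ^^ k) (list_encode xs) = list_encode (drop k xs)"
  by (induction k) (auto simp: drop_Suc tl_drop)

lemma computable_hd_code [computable_intros]: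
  "computable n f \<Longrightarrow> computable n (\<lambda>xs. hd_code (f xs))"
  unfolding hd_code_def by (intro computable_intros)

lemma computable_tl_code [computable_intros]:
  "computable n f \<Longrightarrow> computable n (\<lambda>xs. tl_code (f xs))"
  unfolding tl_code_def by (intro computable_intros)

lemma computable_funpow_tl_code [computable_intros]:
  assumes "computable n f" "computable n g"
  shows "computable n (\<lambda>xs. (tl_code ^^ f xs) (g xs))"
proof -
  have "rec_nat x (\<lambda>k r. tl_code r) y = (tl_code ^^ y) x" for x y by (induction y) auto
  then show ?thesis
    using computable_rec_nat[of n g f "\<lambda>k r xs. tl_code r"] assms
    by (simp add: computable_intros)
qed

lemma list_encode_eq_0_iff: "list_encode xs = 0 \<longleftrightarrow> xs = []"
  by (cases xs) auto

text \<open>The empty list has code 0, so the length is the least number of tails that leads to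
  0.\<close>

lemma computable_length:
  assumes "computable n f"
  shows "computable n (\<lambda>xs. length (list_decode (f xs)))"
proof -
  have z: "(tl_code ^^ k) w = 0 \<longleftrightarrow> length (list_decode w) \<le> k" for k w
    using funpow_tl_code[of k "list_decode w"] by (simp add: list_encode_eq_0_iff)
  have "computable n (\<lambda>xs. LEAST k. (tl_code ^^ k) (f xs) = 0)"
    by (rule computable_Least, intro computable_intros computable_weaken assms) (auto simp: z)
  then show ?thesis
    by (rule computable_cong) (auto simp: z intro!: Least_equality)
qed

lemma computable_append_const:
  assumes "computable n f"
  shows "computable n (\<lambda>xs. list_encode (l @ list_decode (f xs)))"
  by (induction l) (use assms in \<open>auto intro!: computable_intros\<close>)

lemma computable_rotate1: "computable 1 (\<lambda>xs. list_encode (rotate1 (list_decode (xs ! 0))))"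
proof -
  \<comment> \<open>On codes only prepending is direct, so the word is rebuilt from its end: round
    \<open>k\<close> puts the entry at position \<open>length u - Suc k\<close> in front.\<close>
  have snoc: "rec_nat (list_encode [x])
      (\<lambda>k r. Suc (prod_encode (hd_code ((tl_code ^^ (length u - Suc k)) (list_encode u)), r))) m
      = list_encode (drop (length u - m) u @ [x])" if "m \<le> length u" for x u m
    using that
  proof (induction m)
    case (Suc m)
    have "drop (length u - Suc m) u = u ! (length u - Suc m) # drop (length u - m) u"
      using Suc.prems by (metis Cons_nth_drop_Suc Suc_diff_Suc Suc_le_lessD diff_less less_le_trans zero_less_Suc)
    then show ?case using Suc by simp
  qed simp
  define F where "F = (\<lambda>w. rec_nat (Suc (prod_encode (hd_code w, 0)))
      (\<lambda>k r. Suc (prod_encode (hd_code ((tl_code ^^ (length (list_decode (tl_code w)) - Suc k)) (tl_code w)), r)))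
      (length (list_decode (tl_code w))))"
  \<comment> \<open>Without the case distinction the empty word would be sent to 1, the code of
    \<open>[0]\<close>.\<close>
  have F: "(if w = 0 then 0 else F w) = list_encode (rotate1 (list_decode w))" for w
  proof (cases "list_decode w")
    case Nil
    then show ?thesis using list_decode_inverse[of w] by simp
  next
    case (Cons x u)
    then have "w = list_encode (x # u)" using list_decode_inverse[of w] by simp
    then show ?thesis using snoc[of "length u" u x] by (simp add: F_def tl_code_def hd_code_def)
  qed
  have "computable 1 (\<lambda>xs. if xs ! 0 = 0 then 0 else F (xs ! 0))"
    unfolding F_def
    by (intro computable_intros computable_rec_nat computable_length) auto
  then show ?thesis by (simp add: F)
qed

text \<open>Acting at the front is enough, since rotations bring every factor of a cyclic word
  there. A failed match leaves the word alone, so that each rule is a total function.\<close>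

definition apply_rule :: "'a list \<times> 'a list \<Rightarrow> 'a list \<Rightarrow> 'a list" where
  "apply_rule = (\<lambda>(l, r) w. if take (length l) w = l then r @ drop (length l) w else w)"

lemma computable_apply_rule:
  "computable 1 (\<lambda>xs. list_encode (apply_rule lr (list_decode (xs ! 0))))"
proof (cases lr)
  case (Pair l r)
  define rest where "rest = (\<lambda>w. list_decode ((tl_code ^^ length l) w))"
  have rest: "rest w = drop (length l) (list_decode w)" for w
    using funpow_tl_code[of "length l" "list_decode w"] by (simp add: rest_def)
  \<comment> \<open>The prefix test on codes: overwriting the first \<open>length l\<close> entries
    by \<open>l\<close> must give back the same code.\<close>
  have "list_encode (l @ rest w) = w \<longleftrightarrow> l @ rest w = list_decode w" for w
    using list_decode_inverse[of w] by (metis list_encode_inverse)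
  then have *: "list_encode (l @ rest w) = w \<longleftrightarrow> take (length l) (list_decode w) = l" for w
    unfolding rest by (metis append_take_drop_id append_same_eq)
  have "computable 1 (\<lambda>xs. if list_encode (l @ rest (xs ! 0)) = xs ! 0
      then list_encode (r @ rest (xs ! 0)) else xs ! 0)"
    unfolding rest_def by (intro computable_intros computable_append_const) auto
  then show ?thesis
    unfolding * by (rule computable_cong) (simp add: Pair apply_rule_def rest)
qed

section \<open>Bounded reachability is decidable\<close>

text \<open>This is the code of \<open>n\<close> copies of \<open>K\<close>, the largest code of a
  list of length at most \<open>n\<close> with entries at most \<open>K\<close> because pairing is
  monotone.\<close>

fun code_bound :: "nat \<Rightarrow> nat \<Rightarrow> nat" where
  "code_bound K 0 = 0"
| "code_bound K (Suc n) = Suc (prod_encode (K, code_bound K n))"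

lemma triangle_mono: "m \<le> n \<Longrightarrow> triangle m \<le> triangle n"
  unfolding triangle_def by (intro div_le_mono mult_le_mono) auto

lemma prod_encode_mono: "a \<le> c \<Longrightarrow> b \<le> d \<Longrightarrow> prod_encode (a, b) \<le> prod_encode (c, d)"
  by (simp add: prod_encode_def add_mono triangle_mono)

lemma list_encode_le_code_bound:
  "length xs \<le> n \<Longrightarrow> \<forall>x\<in>set xs. x \<le> K \<Longrightarrow> list_encode xs \<le> code_bound K n"
proof (induction xs arbitrary: n)
  case (Cons x xs)
  then show ?case by (cases n) (auto intro: prod_encode_mono)
qed simp

lemma length_le_list_encode: "length xs \<le> list_encode xs"
  by (induction xs) (auto intro: order_trans[OF _ le_prod_encode_2])

lemma computable_code_bound [computable_intros]:
  assumes "computable n f"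
  shows "computable n (\<lambda>xs. code_bound K (f xs))"
proof -
  have "rec_nat 0 (\<lambda>k r. Suc (prod_encode (K, r))) y = code_bound K y" for y by (induction y) auto
  then show ?thesis
    using computable_rec_nat[of n "\<lambda>xs. 0" f "\<lambda>k r xs. Suc (prod_encode (K, r))"] assms
    by (simp add: computable_intros)
qed

section \<open>Walks along finitely many functions\<close>

text \<open>Being the identity out of range, it lets every number drive a walk, whichever list it
  encodes.\<close>

fun select :: "('a \<Rightarrow> 'a) list \<Rightarrow> nat \<Rightarrow> 'a \<Rightarrow> 'a" where
  "select [] i x = x"
| "select (h # hs) i x = (if i = 0 then h x else select hs (i - 1) x)"

lemma select_nth: "i < length hs \<Longrightarrow> select hs i x = (hs ! i) x"
  by (induction hs i x rule: select.induct) (auto simp: nth_Cons')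

lemma select_cases: "select hs i x = x \<or> (\<exists>h\<in>set hs. select hs i x = h x)"
  by (induction hs i x rule: select.induct) auto

lemma computable_select:
  assumes "\<forall>h\<in>set hs. computable 1 (\<lambda>xs. h (xs ! 0))"
    and "computable n f" "computable n g"
  shows "computable n (\<lambda>xs. select hs (f xs) (g xs))"
  using assms(1,2)
proof (induction hs arbitrary: f)
  case (Cons h hs)
  have "computable n (\<lambda>xs. select hs (f xs - 1) (g xs))"
    by (rule Cons.IH) (use Cons.prems in \<open>auto intro!: computable_intros\<close>)
  moreover have "computable n (\<lambda>xs. h (g xs))"
    by (rule computable_subst1[OF _ assms(3)]) (use Cons.prems in auto)
  ultimately show ?case using Cons.prems by (auto intro!: computable_intros)
qed (use assms in simp)

definition graph_of :: "('a \<Rightarrow> 'a) list \<Rightarrow> 'a rel" where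
  "graph_of hs = {(x, h x) | x h. h \<in> set hs}"

text \<open>A walk is driven by a code \<open>s\<close> of the list of indices of the functions applied; the
  index \<open>0\<close>, which is also read off beyond the end of the list, stands for a pause.\<close>

definition walk :: "(nat \<Rightarrow> nat) list \<Rightarrow> nat \<Rightarrow> nat \<Rightarrow> nat \<Rightarrow> nat" where
  "walk hs s x n = rec_nat x (\<lambda>k r. select (id # hs) (hd_code ((tl_code ^^ k) s)) r) n"

lemma walk_0 [simp]: "walk hs s x 0 = x"
  by (simp add: walk_def)

lemma walk_Suc [simp]:
  "walk hs s x (Suc n) = select (id # hs) (hd_code ((tl_code ^^ n) s)) (walk hs s x n)"
  by (simp add: walk_def)

lemma computable_walk:
  assumes "\<forall>h\<in>set hs. computable 1 (\<lambda>xs. h (xs ! 0))"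
    and "computable n f" "computable n g" "computable n m"
  shows "computable n (\<lambda>xs. walk hs (f xs) (g xs) (m xs))"
proof -
  have "\<forall>h\<in>set (id # hs). computable 1 (\<lambda>xs. h (xs ! 0))"
    using assms(1) computable_nth[of 0 1] by simp
  then show ?thesis
    unfolding walk_def
    by (intro computable_rec_nat computable_select computable_intros computable_weaken assms(2-4)) auto
qed

lemma walk_rtrancl: "(x, walk hs s x n) \<in> (graph_of hs)\<^sup>*"
proof (induction n)
  case (Suc n)
  let ?i = "hd_code ((tl_code ^^ n) s)"
  have "walk hs s x (Suc n) = select (id # hs) ?i (walk hs s x n)" by (rule walk_Suc)
  then have "walk hs s x (Suc n) = walk hs s x n \<or> (walk hs s x n, walk hs s x (Suc n)) \<in> graph_of hs"
    using select_cases[of "id # hs" ?i "walk hs s x n"] by (auto simp: graph_of_def)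
  with Suc show ?case by (metis rtrancl.rtrancl_into_rtrancl)
qed simp

lemma walk_pause: "walk hs (list_encode is) x (length is + k) = walk hs (list_encode is) x (length is)"
  by (induction k) auto

lemma relpow_mono: "(R :: 'a rel) \<subseteq> S \<Longrightarrow> R ^^ n \<subseteq> S ^^ n"
  by (induction n) auto

lemma relpow_walk:
  assumes "(x, y) \<in> graph_of hs ^^ n"
  obtains "is" where "length is = n" "\<forall>i\<in>set is. i \<le> length hs" "walk hs (list_encode is) x n = y"
  using assms
proof (induction n arbitrary: y thesis)
  case 0
  then show ?case by auto
next
  case (Suc n)
  then obtain z h where z: "(x, z) \<in> graph_of hs ^^ n" "h \<in> set hs" "y = h z"
    by (auto simp: graph_of_def)
  then obtain i where i: "i < length hs" "h = hs ! i" by (auto simp: in_set_conv_nth)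
  obtain "is" where "is": "length is = n" "\<forall>i\<in>set is. i \<le> length hs" "walk hs (list_encode is) x n = z"
    using Suc.IH z(1) by blast
  \<comment> \<open>In the first \<open>n\<close> rounds both codes yield the same index; the
    appended one is read only in round \<open>n\<close>.\<close>
  have agree: "walk hs (list_encode (is @ [Suc i])) x m = walk hs (list_encode is) x m" if "m \<le> n" for m
    using that
  proof (induction m)
    case (Suc m)
    then have "drop m (is @ [Suc i]) = is ! m # drop (Suc m) is @ [Suc i]" "drop m is = is ! m # drop (Suc m) is"
      using "is"(1) by (simp_all add: Cons_nth_drop_Suc)
    then show ?case using Suc by (simp del: drop_append)
  qed simp
  have "walk hs (list_encode (is @ [Suc i])) x (Suc n) = y"
    using agree[of n] "is" i z by (simp add: select_nth)
  then show ?case using Suc.prems(1)[of "is @ [Suc i]"] "is" i by auto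
qed

text \<open>The guarantee is made for each pair \<open>x\<close>, \<open>y\<close> separately,
  because at numbers that encode no word over the alphabet nothing bounds the search. A walk found
  by the search is always a genuine path; the bound is needed only to be sure of finding
  one.\<close>

theorem bounded_reachability:
  assumes hs: "\<forall>h\<in>set hs. computable 1 (\<lambda>xs. h (xs ! 0))"
    and b: "computable 2 (\<lambda>xs. b (xs ! 0) (xs ! 1))"
  obtains f where "recursive 2 f"
    "\<And>x y. ((x, y) \<in> (graph_of hs)\<^sup>* \<Longrightarrow> (x, y) \<in> (graph_of hs \<inter> {..<b x y} \<times> {..<b x y})\<^sup>*)
      \<Longrightarrow> f [x, y] = (if (x, y) \<in> (graph_of hs)\<^sup>* then 1 else 0)"
proof -
  \<comment> \<open>Below the bound the relation has at most \<open>b x y * b x y\<close> pairs, and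
    a shortest path has no more steps than that. \<open>M\<close> exceeds every code of an index
    list of such a length; shorter walks are padded by pauses.\<close>
  define N where "N = (\<lambda>x y. b x y * b x y)"
  define M where "M = (\<lambda>x y. Suc (code_bound (length hs) (N x y)))"
  have "computable 2 (\<lambda>xs. if \<exists>s<M (xs ! 0) (xs ! 1). walk hs s (xs ! 0) (N (xs ! 0) (xs ! 1)) = xs ! 1 then 1 else 0)"
    unfolding M_def N_def
    by (intro computable_bex computable_walk[OF hs] computable_intros computable_subst2[OF b]) auto
  then obtain f where f: "recursive 2 f"
    "\<And>x y. f [x, y] = (if \<exists>s<M x y. walk hs s x (N x y) = y then 1 else 0)"
    unfolding computable_def by (auto simp: numeral_2_eq_2)
  show ?thesis
  proof (rule that[OF f(1)])
    fix x y
    assume bounded: "(x, y) \<in> (graph_of hs)\<^sup>* \<Longrightarrow> (x, y) \<in> (graph_of hs \<inter> {..<b x y} \<times> {..<b x y})\<^sup>*"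
    let ?R = "graph_of hs \<inter> {..<b x y} \<times> {..<b x y}"
    have "\<exists>s<M x y. walk hs s x (N x y) = y" if "(x, y) \<in> (graph_of hs)\<^sup>*"
    proof -
      have fin: "finite ?R" by auto
      have card: "card ?R \<le> N x y"
        unfolding N_def using card_mono[of "{..<b x y} \<times> {..<b x y}" ?R] by (simp add: card_cartesian_product)
      from bounded[OF that] obtain n where n: "n \<le> card ?R" "(x, y) \<in> ?R ^^ n"
        unfolding rtrancl_finite_eq_relpow[OF fin] by auto
      from n(2) have "(x, y) \<in> graph_of hs ^^ n"
        using relpow_mono[of ?R "graph_of hs" n] by auto
      then obtain "is" where "is": "length is = n" "\<forall>i\<in>set is. i \<le> length hs" "walk hs (list_encode is) x n = y"
        by (rule relpow_walk)
      have "list_encode is < M x y"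
        unfolding M_def using "is" n card by (auto intro!: le_imp_less_Suc list_encode_le_code_bound)
      moreover have "walk hs (list_encode is) x (N x y) = y"
        using walk_pause[of hs "is" x "N x y - n"] "is" n card by simp
      ultimately show ?thesis by blast
    qed
    then show "f [x, y] = (if (x, y) \<in> (graph_of hs)\<^sup>* then 1 else 0)"
      unfolding f(2) using walk_rtrancl[of x hs _ "N x y"] by metis
  qed
qed

section \<open>Confluence of cyclic cancellation\<close>

locale twisting =
  fixes adj :: "'v \<Rightarrow> 'v \<Rightarrow> bool" and tw :: "'v \<Rightarrow> 'v \<Rightarrow> bool"
  assumes adj_sym: "adj a b \<Longrightarrow> adj b a" and adj_irrefl: "\<not> adj a a"
begin

text \<open>\<open>tw a b\<close> means that moving \<open>a\<close> past \<open>b\<close> inverts \<open>b\<close>. Moving a letter on the vertex \<open>a\<close>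
  past the word \<open>w\<close> turns \<open>w\<close> into \<open>flip a w\<close> and inverts the letter iff \<open>par a w\<close>.\<close>

definition flip :: "'v \<Rightarrow> 'v letter list \<Rightarrow> 'v letter list" where
  "flip a = map (\<lambda>(c, e). (c, e \<noteq> tw a c))"

fun par :: "'v \<Rightarrow> 'v letter list \<Rightarrow> bool" where
  "par a [] = False"
| "par a (x # w) = (tw (fst x) a \<noteq> par a w)"

definition past :: "'v \<Rightarrow> 'v letter list \<Rightarrow> bool" where
  "past a w \<longleftrightarrow> (\<forall>x\<in>set w. adj a (fst x))"

text \<open>Swaps act at the front only; conjugated by rotations they act everywhere, and the case
  analysis of marked pairs stays short.\<close>

inductive shuffle :: "'v letter list \<Rightarrow> 'v letter list \<Rightarrow> bool" where
  swap: "adj a b \<Longrightarrow> shuffle ((a, e) # (b, f) # w) ((b, f \<noteq> tw a b) # (a, e \<noteq> tw b a) # w)"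
| rot: "shuffle (x # w) (w @ [x])"

inductive lstep :: "'v letter list \<Rightarrow> 'v letter list \<Rightarrow> bool" where
  lshuffle: "shuffle w w' \<Longrightarrow> lstep w w'"
| lflip: "past a w \<Longrightarrow> \<not> par a w \<Longrightarrow> lstep w (flip a w)"

inductive cancel :: "'v letter list \<Rightarrow> 'v letter list \<Rightarrow> bool" where
  cancel: "cancel ((a, e) # (a, \<not> e) # w) w"

definition step :: "'v letter list \<Rightarrow> 'v letter list \<Rightarrow> bool" where
  "step w w' \<longleftrightarrow> lstep w w' \<or> cancel w w'"

abbreviation conv :: "'v letter list \<Rightarrow> 'v letter list \<Rightarrow> bool" where
  "conv \<equiv> (\<lambda>u v. step u v \<or> step v u)\<^sup>*\<^sup>*"

section \<open>Signs, derived moves and their inverses\<close>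

lemma flip_simps [simp]:
  "flip a [] = []" "flip a ((c, e) # w) = (c, e \<noteq> tw a c) # flip a w"
  "flip a (v @ w) = flip a v @ flip a w" "length (flip a w) = length w"
  by (simp_all add: flip_def)

lemma flip_flip [simp]: "flip a (flip a w) = w"
  by (induction w) auto

lemma flip_commute: "flip a (flip b w) = flip b (flip a w)"
  by (induction w) auto

lemma par_append [simp]: "par a (v @ w) = (par a v \<noteq> par a w)"
  by (induction v) auto

lemma par_flip [simp]: "par a (flip b w) = par a w"
  by (induction w) auto

lemma past_simps [simp]:
  "past a []" "past a (x # w) \<longleftrightarrow> adj a (fst x) \<and> past a w"
  "past a (v @ w) \<longleftrightarrow> past a v \<and> past a w"
  by (auto simp: past_def)

lemma past_flip [simp]: "past a (flip b w) = past a w"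
  by (induction w) auto

lemma length_shuffle: "shuffle w w' \<Longrightarrow> length w' = length w"
  by (induction rule: shuffle.induct) auto

lemma length_lstep: "lstep w w' \<Longrightarrow> length w' = length w"
  by (induction rule: lstep.induct) (auto simp: length_shuffle)

lemma length_lsteps: "lstep\<^sup>*\<^sup>* w w' \<Longrightarrow> length w' = length w"
  by (induction rule: rtranclp_induct) (auto simp: length_lstep)

lemma shuffles_lsteps: "shuffle\<^sup>*\<^sup>* w w' \<Longrightarrow> lstep\<^sup>*\<^sup>* w w'"
  by (rule rtranclp_mono[THEN predicate2D, of shuffle]) (auto intro: lshuffle)

lemma lsteps_steps: "lstep\<^sup>*\<^sup>* w w' \<Longrightarrow> step\<^sup>*\<^sup>* w w'"
  by (rule rtranclp_mono[THEN predicate2D, of lstep]) (auto simp: step_def)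

lemma shuffles_steps: "shuffle\<^sup>*\<^sup>* w w' \<Longrightarrow> step\<^sup>*\<^sup>* w w'"
  by (intro lsteps_steps shuffles_lsteps)

lemma steps_conv: "step\<^sup>*\<^sup>* w w' \<Longrightarrow> conv w w'"
  by (rule rtranclp_mono[THEN predicate2D, of step]) auto

lemma conv_sym: "conv u v \<Longrightarrow> conv v u"
proof (induction rule: rtranclp_induct)
  case (step v w)
  then have "step w v \<or> step v w" by blast
  then show ?case using step.IH by (rule converse_rtranclp_into_rtranclp)
qed simp

lemma rotate: "shuffle\<^sup>*\<^sup>* (u @ v) (v @ u)"
proof (induction u arbitrary: v)
  case (Cons x u)
  have "shuffle ((x # u) @ v) (u @ v @ [x])" using rot[of x "u @ v"] by simp
  also have "shuffle\<^sup>*\<^sup>* (u @ v @ [x]) ((v @ [x]) @ u)" by (rule Cons.IH)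
  finally show ?case by simp
qed simp

lemma swap_inside:
  assumes "adj a b"
  shows "shuffle\<^sup>*\<^sup>* (u @ (a, e) # (b, f) # v) (u @ (b, f \<noteq> tw a b) # (a, e \<noteq> tw b a) # v)"
proof -
  have "shuffle\<^sup>*\<^sup>* (u @ (a, e) # (b, f) # v) ((a, e) # (b, f) # v @ u)"
    using rotate[of u "(a, e) # (b, f) # v"] by simp
  also have "shuffle ((a, e) # (b, f) # v @ u) ((b, f \<noteq> tw a b) # (a, e \<noteq> tw b a) # v @ u)"
    using assms by (rule swap)
  also have "shuffle\<^sup>*\<^sup>* ((b, f \<noteq> tw a b) # (a, e \<noteq> tw b a) # v @ u) (u @ (b, f \<noteq> tw a b) # (a, e \<noteq> tw b a) # v)"
    using rotate[of "(b, f \<noteq> tw a b) # (a, e \<noteq> tw b a) # v" u] by simp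
  finally show ?thesis .
qed

lemma move_past:
  assumes "past a p"
  shows "shuffle\<^sup>*\<^sup>* (u @ (a, e) # p @ r) (u @ flip a p @ (a, e \<noteq> par a p) # r)"
  using assms
proof (induction p arbitrary: u e)
  case (Cons x p)
  obtain b f where x: "x = (b, f)" by (cases x)
  have "shuffle\<^sup>*\<^sup>* (u @ (a, e) # (x # p) @ r) ((u @ [(b, f \<noteq> tw a b)]) @ (a, e \<noteq> tw b a) # p @ r)"
    using swap_inside[of a b u e f "p @ r"] Cons.prems x by simp
  also have "shuffle\<^sup>*\<^sup>* \<dots> ((u @ [(b, f \<noteq> tw a b)]) @ flip a p @ (a, (e \<noteq> tw b a) \<noteq> par a p) # r)"
    using Cons.IH[of "u @ [(b, f \<noteq> tw a b)]" "e \<noteq> tw b a"] Cons.prems by simp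
  also have "((e \<noteq> tw b a) \<noteq> par a p) = (e \<noteq> par a (x # p))" by (auto simp: x)
  finally show ?case by (simp add: x)
qed simp

lemma cancel_inside: "step\<^sup>*\<^sup>* (u @ (a, e) # (a, \<not> e) # v) (u @ v)"
proof -
  have "step\<^sup>*\<^sup>* (u @ (a, e) # (a, \<not> e) # v) ((a, e) # (a, \<not> e) # v @ u)"
    using shuffles_steps[OF rotate[of u "(a, e) # (a, \<not> e) # v"]] by simp
  also have "step ((a, e) # (a, \<not> e) # v @ u) (v @ u)"
    unfolding step_def by (blast intro: cancel)
  also have "step\<^sup>*\<^sup>* (v @ u) (u @ v)" by (rule shuffles_steps[OF rotate])
  finally show ?thesis .
qed

lemma shuffle_sym: "shuffle w w' \<Longrightarrow> shuffle\<^sup>*\<^sup>* w' w"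
proof (induction rule: shuffle.induct)
  case (swap a b e f w)
  have *: "shuffle ((b, f \<noteq> tw a b) # (a, e \<noteq> tw b a) # w)
      ((a, (e \<noteq> tw b a) \<noteq> tw b a) # (b, (f \<noteq> tw a b) \<noteq> tw a b) # w)"
    by (rule shuffle.swap[OF adj_sym[OF swap]])
  have "((e \<noteq> tw b a) \<noteq> tw b a) = e" "((f \<noteq> tw a b) \<noteq> tw a b) = f" by auto
  show ?case
    using * unfolding \<open>((e \<noteq> tw b a) \<noteq> tw b a) = e\<close> \<open>((f \<noteq> tw a b) \<noteq> tw a b) = f\<close>
    by (rule r_into_rtranclp)
next
  case (rot x w)
  show ?case using rotate[of w "[x]"] by simp
qed

text \<open>\<open>past\<close> and \<open>par\<close> look only at vertices, so after a flip the
  same flip is allowed again and undoes it. Hence length-preserving moves generate an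
  equivalence.\<close>

lemma lstep_sym: "lstep w w' \<Longrightarrow> lstep\<^sup>*\<^sup>* w' w"
proof (induction rule: lstep.induct)
  case (lshuffle w w')
  then show ?case by (intro shuffles_lsteps shuffle_sym)
next
  case (lflip a w)
  then show ?case using lstep.lflip[of a "flip a w"] by auto
qed

lemma lsteps_sym: "lstep\<^sup>*\<^sup>* w w' \<Longrightarrow> lstep\<^sup>*\<^sup>* w' w"
  by (induction rule: rtranclp_induct) (auto intro: lstep_sym rtranclp_trans)

text \<open>\<open>marked w c\<close>: the cyclic word \<open>w\<close> contains a pair of letters on a vertex \<open>a\<close> that would
  cancel after one of them has been moved past the arc \<open>p\<close> between them, and \<open>c\<close> is the result
  of this cancellation. In the second form the cut of the cyclic word lies within the arc,
  which is then \<open>p1 @ p2\<close>.\<close>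

inductive marked :: "'v letter list \<Rightarrow> 'v letter list \<Rightarrow> bool" where
  marked1: "past a p \<Longrightarrow> e' = (e = par a p) \<Longrightarrow>
    marked (q2 @ (a, e) # p @ (a, e') # q1) (q2 @ flip a p @ q1)"
| marked2: "past a p1 \<Longrightarrow> past a p2 \<Longrightarrow> e' = (e = (par a p1 \<noteq> par a p2)) \<Longrightarrow>
    marked (p2 @ (a, e') # q @ (a, e) # p1) (flip a p2 @ q @ flip a p1)"

lemma marked_steps: "marked w c \<Longrightarrow> step\<^sup>*\<^sup>* w c"
proof (induction rule: marked.induct)
  case (marked1 a p e' e q2 q1)
  have "step\<^sup>*\<^sup>* (q2 @ (a, e) # p @ (a, e') # q1) (q2 @ flip a p @ (a, e \<noteq> par a p) # (a, e') # q1)"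
    by (rule shuffles_steps[OF move_past[OF marked1(1)]])
  also have "step\<^sup>*\<^sup>* \<dots> (q2 @ flip a p @ q1)"
    using cancel_inside[of "q2 @ flip a p" a "e \<noteq> par a p" q1] marked1 by simp
  finally show ?case .
next
  case (marked2 a p1 p2 e' e q)
  have "step\<^sup>*\<^sup>* (p2 @ (a, e') # q @ (a, e) # p1) ((a, e) # p1 @ p2 @ (a, e') # q)"
    using shuffles_steps[OF rotate[of "p2 @ (a, e') # q" "(a, e) # p1"]] by simp
  also have "step\<^sup>*\<^sup>* \<dots> (flip a (p1 @ p2) @ (a, e \<noteq> par a (p1 @ p2)) # (a, e') # q)"
    using shuffles_steps[OF move_past[of a "p1 @ p2" "[]" e "(a, e') # q"]] marked2 by simp
  also have "step\<^sup>*\<^sup>* \<dots> (flip a (p1 @ p2) @ q)"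
    using cancel_inside[of "flip a (p1 @ p2)" a "e \<noteq> par a (p1 @ p2)" q] marked2 by simp
  also have "step\<^sup>*\<^sup>* (flip a (p1 @ p2) @ q) (flip a p2 @ q @ flip a p1)"
    using shuffles_steps[OF rotate[of "flip a p1" "flip a p2 @ q"]] by simp
  finally show ?case .
qed

section \<open>Tracing a marked pair\<close>

text \<open>At most one of the swapped letters is marked, as no vertex is adjacent to itself. If one
  is, the other enters or leaves the arc; modulo two it is flipped equally often with and without
  the swap, so \<open>c\<close> does not change. Otherwise the swap is repeated in
  \<open>c\<close>.\<close>

lemma marked_swap:
  assumes "marked ((x, f) # (y, g) # r) c" and adj: "adj x y"
  shows "\<exists>c'. marked ((y, g \<noteq> tw x y) # (x, f \<noteq> tw y x) # r) c' \<and> lstep\<^sup>*\<^sup>* c c'"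
  using assms(1)
proof cases
  case (marked1 a p e' e q2 q1)
  consider "q2 = []" | z where "q2 = [z]" | z z' q where "q2 = z # z' # q"
    by (metis list.exhaust)
  then show ?thesis
  proof cases
    case 1
    with marked1 adj obtain p' where p: "p = (y, g) # p'" by (cases p) (auto simp: adj_irrefl)
    with 1 marked1 have "x = a" "f = e" "r = p' @ (a, e') # q1" by auto
    moreover have "marked ([(y, g \<noteq> tw a y)] @ (a, e \<noteq> tw y a) # p' @ (a, e') # q1) ([(y, g \<noteq> tw a y)] @ flip a p' @ q1)"
      using marked1 p by (intro marked.marked1) auto
    ultimately show ?thesis using 1 marked1 p by auto
  next
    case 2
    have "marked ([] @ (a, e \<noteq> tw x a) # ((x, f \<noteq> tw a x) # p) @ (a, e') # q1)
        ([] @ flip a ((x, f \<noteq> tw a x) # p) @ q1)"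
      using marked1 2 adj by (intro marked.marked1) (auto intro: adj_sym)
    moreover have "flip a ((x, f \<noteq> tw a x) # p) = (x, f) # flip a p" by auto
    ultimately show ?thesis using 2 marked1 by auto
  next
    case 3
    have "marked (((y, g \<noteq> tw x y) # (x, f \<noteq> tw y x) # q) @ (a, e) # p @ (a, e') # q1)
        (((y, g \<noteq> tw x y) # (x, f \<noteq> tw y x) # q) @ flip a p @ q1)"
      using marked1 by (intro marked.marked1) auto
    moreover have "lstep c (((y, g \<noteq> tw x y) # (x, f \<noteq> tw y x) # q) @ flip a p @ q1)"
      using lshuffle[OF swap[OF adj, of f g "q @ flip a p @ q1"]] 3 marked1 by simp
    ultimately show ?thesis using 3 marked1 by auto
  qed
next
  case (marked2 a p1 p2 e' e q)
  consider "p2 = []" | z where "p2 = [z]" | z z' p where "p2 = z # z' # p"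
    by (metis list.exhaust)
  then show ?thesis
  proof cases
    case 1
    with marked2 adj obtain q' where q: "q = (y, g) # q'" by (cases q) (auto simp: adj_irrefl)
    have "marked ([(y, g \<noteq> tw a y)] @ (a, e' \<noteq> tw y a) # q' @ (a, e) # p1)
        (flip a [(y, g \<noteq> tw a y)] @ q' @ flip a p1)"
      using marked2 adj 1 q by (intro marked.marked2) auto
    moreover have "flip a [(y, g \<noteq> tw a y)] = [(y, g)]" by auto
    ultimately show ?thesis using 1 marked2 q by auto
  next
    case 2
    have "marked ([] @ (a, e' \<noteq> tw x a) # ((x, f \<noteq> tw a x) # q) @ (a, e) # p1)
        (flip a [] @ ((x, f \<noteq> tw a x) # q) @ flip a p1)"
      using marked2 2 adj by (intro marked.marked2) auto
    then show ?thesis using 2 marked2 by auto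
  next
    case 3
    have "marked (((y, g \<noteq> tw x y) # (x, f \<noteq> tw y x) # p) @ (a, e') # q @ (a, e) # p1)
        (flip a ((y, g \<noteq> tw x y) # (x, f \<noteq> tw y x) # p) @ q @ flip a p1)"
      using marked2 3 by (intro marked.marked2) auto
    moreover have "lstep c (flip a ((y, g \<noteq> tw x y) # (x, f \<noteq> tw y x) # p) @ q @ flip a p1)"
    proof -
      have "((g \<noteq> tw a y) \<noteq> tw x y) = ((g \<noteq> tw x y) \<noteq> tw a y)"
        "((f \<noteq> tw a x) \<noteq> tw y x) = ((f \<noteq> tw y x) \<noteq> tw a x)" by argo+
      moreover have "c = (x, f \<noteq> tw a x) # (y, g \<noteq> tw a y) # flip a p @ q @ flip a p1"
        using 3 marked2 by auto
      ultimately show ?thesis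
        using lshuffle[OF swap[OF adj, of "f \<noteq> tw a x" "g \<noteq> tw a y" "flip a p @ q @ flip a p1"]]
        by (simp only: flip_simps append_Cons)
    qed
    ultimately show ?thesis using 3 marked2 by auto
  qed
qed

text \<open>When a marked letter passes from the front to the end, the cut enters or leaves the arc
  and the two forms of \<open>marked\<close> are exchanged.\<close>

lemma marked_rot:
  assumes "marked (x # r) c"
  shows "\<exists>c'. marked (r @ [x]) c' \<and> lstep\<^sup>*\<^sup>* c c'"
  using assms
proof cases
  case (marked1 a p e' e q2 q1)
  show ?thesis
  proof (cases q2)
    case Nil
    have "marked (p @ (a, e') # q1 @ (a, e) # []) (flip a p @ q1 @ flip a [])"
      using marked1 by (intro marked.marked2) auto
    then show ?thesis using marked1 Nil by auto
  next
    case (Cons z q)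
    have "marked (q @ (a, e) # p @ (a, e') # q1 @ [x]) (q @ flip a p @ q1 @ [x])"
      using marked1 by (intro marked.marked1) auto
    moreover have "lstep c (q @ flip a p @ q1 @ [x])"
      using lshuffle[OF rot[of x "q @ flip a p @ q1"]] marked1 Cons by simp
    ultimately show ?thesis using marked1 Cons by auto
  qed
next
  case (marked2 a p1 p2 e' e q)
  show ?thesis
  proof (cases p2)
    case Nil
    have "marked (q @ (a, e) # p1 @ (a, e') # []) (q @ flip a p1 @ [])"
      using marked2 Nil by (intro marked.marked1) auto
    then show ?thesis using marked2 Nil by auto
  next
    case (Cons z p)
    have "marked (p @ (a, e') # q @ (a, e) # p1 @ [x]) (flip a p @ q @ flip a (p1 @ [x]))"
      using marked2 Cons by (intro marked.marked2) auto
    moreover have "lstep c (flip a p @ q @ flip a (p1 @ [x]))"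
    proof -
      obtain b f where "x = (b, f)" by (cases x)
      then show ?thesis
        using lshuffle[OF rot[of "(b, f \<noteq> tw a b)" "flip a p @ q @ flip a p1"]] marked2 Cons by auto
    qed
    ultimately show ?thesis using marked2 Cons by auto
  qed
qed

text \<open>Flips commute, and the two marked letters contribute equally to \<open>par b\<close>; so
  the flip by \<open>b\<close> is allowed on \<open>c\<close> as well.\<close>

lemma marked_flip:
  assumes "marked w c" "past b w" "\<not> par b w"
  shows "marked (flip b w) (flip b c) \<and> lstep c (flip b c)"
  using assms(1)
proof cases
  case (marked1 a p e' e q2 q1)
  have "marked (flip b q2 @ (a, e \<noteq> tw b a) # flip b p @ (a, e' \<noteq> tw b a) # flip b q1)
      (flip b q2 @ flip a (flip b p) @ flip b q1)"
    using marked1 by (intro marked.marked1) auto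
  moreover have "lstep c (flip b c)" using assms marked1 by (intro lflip) auto
  ultimately show ?thesis using marked1 by (simp add: flip_commute)
next
  case (marked2 a p1 p2 e' e q)
  have "marked (flip b p2 @ (a, e' \<noteq> tw b a) # flip b q @ (a, e \<noteq> tw b a) # flip b p1)
      (flip a (flip b p2) @ flip b q @ flip a (flip b p1))"
    using marked2 by (intro marked.marked2) auto
  moreover have "lstep c (flip b c)" using assms marked2 by (intro lflip) auto
  ultimately show ?thesis using marked2 by (simp add: flip_commute)
qed

lemma marked_lstep:
  assumes "lstep w w'" "marked w c"
  shows "\<exists>c'. marked w' c' \<and> lstep\<^sup>*\<^sup>* c c'"
  using assms
proof (induction rule: lstep.induct)
  case (lshuffle w w')
  from lshuffle(1) show ?case
  proof cases
    case (swap a b e f r)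
    then show ?thesis using marked_swap[of a e b f r c] lshuffle(2) by simp
  next
    case (rot x r)
    then show ?thesis using marked_rot[of x r c] lshuffle(2) by simp
  qed
next
  case (lflip a w)
  then show ?case by (blast dest: marked_flip)
qed

text \<open>These are the critical pairs: the front pair may coincide with the marked pair, share
  one letter with it, or be disjoint from it.\<close>

lemma marked_cancel:
  assumes "marked ((x, f) # (x, \<not> f) # r) c"
  shows "\<exists>d. step\<^sup>*\<^sup>* r d \<and> step\<^sup>*\<^sup>* c d"
  using assms
proof cases
  case (marked1 a p e' e q2 q1)
  consider "q2 = []" | z where "q2 = [z]" | z z' q where "q2 = z # z' # q"
    by (metis list.exhaust)
  then show ?thesis
  proof cases
    case 1
    \<comment> \<open>The arc contains no letter on \<open>a\<close>, so the two pairs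
      coincide.\<close>
    have "p = []"
      using marked1(1,3) 1 by (cases p) (auto simp: adj_irrefl)
    with 1 have "r = c" using marked1(1,2) by simp
    then show ?thesis by blast
  next
    case 2
    \<comment> \<open>One letter is shared. Each result keeps one letter on \<open>a\<close>, and
      carrying it past the arc turns one result into the other.\<close>
    have "step\<^sup>*\<^sup>* ((a, \<not> e) # flip a p @ q1) (p @ (a, \<not> e \<noteq> par a p) # q1)"
      using shuffles_steps[OF move_past[of a "flip a p" "[]" "\<not> e" q1]] marked1 by simp
    moreover have "(\<not> e \<noteq> par a p) = e'" using marked1 by auto
    ultimately show ?thesis using marked1 2 by auto
  next
    case 3
    have "marked (q @ (a, e) # p @ (a, e') # q1) (q @ flip a p @ q1)"
      using marked1 by (intro marked.marked1) auto
    from marked_steps[OF this] show ?thesis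
      using marked1 3 cancel[of x f "q @ flip a p @ q1"]
      by (intro exI[of _ "q @ flip a p @ q1"]) (simp add: step_def r_into_rtranclp)
  qed
next
  case (marked2 a p1 p2 e' e q)
  consider "p2 = []" "q = []" | z q' where "p2 = []" "q = z # q'" | z where "p2 = [z]"
    | z z' p where "p2 = z # z' # p"
    by (metis list.exhaust)
  then show ?thesis
  proof cases
    case 1
    \<comment> \<open>The same two letters cancel on either side of the cycle, leaving
      \<open>p1\<close> and \<open>flip a p1\<close>. Comparing the two sign conditions gives
      \<open>\<not> par a p1\<close>, which is exactly what the extra move demands.\<close>
    then have "lstep r c" using marked2 lflip[of a p1] by auto
    then have "step r c" by (simp add: step_def)
    then show ?thesis by blast
  next
    case 2
    \<comment> \<open>Again one letter is shared; the surviving letter on \<open>a\<close> is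
      carried past the arc \<open>p1\<close> across the cut.\<close>
    have s1: "step\<^sup>*\<^sup>* (q' @ (a, e) # p1) ((a, e) # p1 @ q')"
      using shuffles_steps[OF rotate[of q' "(a, e) # p1"]] by simp
    have s2: "step\<^sup>*\<^sup>* ((a, e) # p1 @ q') (flip a p1 @ (a, e \<noteq> par a p1) # q')"
      using shuffles_steps[OF move_past[OF marked2(3), of "[]" e q']] by simp
    have s3: "step\<^sup>*\<^sup>* (flip a p1 @ (a, e \<noteq> par a p1) # q') ((a, e \<noteq> par a p1) # q' @ flip a p1)"
      using shuffles_steps[OF rotate[of "flip a p1" "(a, e \<noteq> par a p1) # q'"]] by simp
    have "step\<^sup>*\<^sup>* (q' @ (a, e) # p1) ((a, e \<noteq> par a p1) # q' @ flip a p1)"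
      by (rule rtranclp_trans[OF rtranclp_trans[OF s1 s2] s3])
    moreover have "r = q' @ (a, e) # p1" "c = z # q' @ flip a p1"
      using marked2(1,2) 2 by simp_all
    moreover have "z = (a, \<not> e')"
      using marked2(1) 2 by auto
    moreover have "(e \<noteq> par a p1) = (\<not> e')"
      using marked2(5) 2 by simp
    ultimately show ?thesis by auto
  next
    case 3
    \<comment> \<open>The first letter would lie in the arc and be on \<open>a\<close>
      itself.\<close>
    then show ?thesis using marked2 by (auto simp: adj_irrefl)
  next
    case 4
    have "marked (p @ (a, e') # q @ (a, e) # p1) (flip a p @ q @ flip a p1)"
      using marked2 4 by (intro marked.marked2) auto
    from marked_steps[OF this] have r: "step\<^sup>*\<^sup>* r (flip a p @ q @ flip a p1)"
      using marked2 4 by simp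
    \<comment> \<open>The front pair lies in the arc; the flip inverts both of its letters or
      neither, so it still cancels in \<open>c\<close>.\<close>
    have "c = (x, f \<noteq> tw a x) # (x, \<not> (f \<noteq> tw a x)) # flip a p @ q @ flip a p1"
      using marked2(1,2) 4 by auto
    then have "cancel c (flip a p @ q @ flip a p1)"
      by (simp only: cancel)
    then have "step c (flip a p @ q @ flip a p1)" by (simp add: step_def)
    with r show ?thesis by blast
  qed
qed

section \<open>Confluence modulo length-preserving moves\<close>

text \<open>The first pair is marked with an empty arc. Traced to \<open>w'\<close>, it is compared
  there with the pair of the second cancellation.\<close>

lemma local_confluence:
  assumes "cancel w u" "lstep\<^sup>*\<^sup>* w w'" "cancel w' v"
  shows "\<exists>d. step\<^sup>*\<^sup>* u d \<and> step\<^sup>*\<^sup>* v d"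
proof -
  from assms(2,1) have "\<exists>c. marked w' c \<and> lstep\<^sup>*\<^sup>* u c"
  proof (induction rule: rtranclp_induct)
    case base
    then obtain a e where "w = (a, e) # (a, \<not> e) # u" by (auto elim: cancel.cases)
    then show ?case using marked1[of a "[]" "\<not> e" e "[]" u] by auto
  next
    case (step y z)
    then obtain c where "marked y c" "lstep\<^sup>*\<^sup>* u c" by blast
    with marked_lstep[OF step(2)] show ?case by (blast intro: rtranclp_trans)
  qed
  then obtain c where c: "marked w' c" "lstep\<^sup>*\<^sup>* u c" by blast
  from assms(3) obtain x f where "w' = (x, f) # (x, \<not> f) # v" by (auto elim: cancel.cases)
  with c(1) obtain d where "step\<^sup>*\<^sup>* v d" "step\<^sup>*\<^sup>* c d" using marked_cancel by blast
  then show ?thesis using rtranclp_trans[OF lsteps_steps[OF c(2)]] by blast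
qed

lemma steps_cases:
  assumes "step\<^sup>*\<^sup>* w a"
  shows "lstep\<^sup>*\<^sup>* w a \<or> (\<exists>w' a'. lstep\<^sup>*\<^sup>* w w' \<and> cancel w' a' \<and> step\<^sup>*\<^sup>* a' a)"
  using assms
proof (induction rule: converse_rtranclp_induct)
  case (step y z)
  from step(1) consider "lstep y z" | "cancel y z" unfolding step_def by blast
  then show ?case
  proof cases
    case 1
    then show ?thesis using step.IH converse_rtranclp_into_rtranclp[of lstep y z] by blast
  next
    case 2
    then show ?thesis using step(2) by blast
  qed
qed simp

text \<open>Newman's diamond argument, with the length in place of termination: a branch without
  cancellation is run backwards, and otherwise the first cancellations on both sides lead to shorter
  words.\<close>

lemma confluence: "step\<^sup>*\<^sup>* w a \<Longrightarrow> step\<^sup>*\<^sup>* w b \<Longrightarrow> \<exists>d. step\<^sup>*\<^sup>* a d \<and> step\<^sup>*\<^sup>* b d"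
proof (induction "length w" arbitrary: w a b rule: less_induct)
  case less
  show ?case
  proof (cases "lstep\<^sup>*\<^sup>* w a \<or> lstep\<^sup>*\<^sup>* w b")
    case True
    then show ?thesis
    proof
      assume "lstep\<^sup>*\<^sup>* w a"
      then have "step\<^sup>*\<^sup>* a w" by (rule lsteps_steps[OF lsteps_sym])
      then have "step\<^sup>*\<^sup>* a b" using less.prems(2) by (rule rtranclp_trans)
      then show ?thesis by blast
    next
      assume "lstep\<^sup>*\<^sup>* w b"
      then have "step\<^sup>*\<^sup>* b w" by (rule lsteps_steps[OF lsteps_sym])
      then have "step\<^sup>*\<^sup>* b a" using less.prems(1) by (rule rtranclp_trans)
      then show ?thesis by blast
    qed
  next
    case False
    then obtain u a' v b' where u: "lstep\<^sup>*\<^sup>* w u" "cancel u a'" "step\<^sup>*\<^sup>* a' a"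
      and v: "lstep\<^sup>*\<^sup>* w v" "cancel v b'" "step\<^sup>*\<^sup>* b' b"
      using steps_cases[OF less.prems(1)] steps_cases[OF less.prems(2)] by blast
    have len: "length a' < length w" "length b' < length w"
      using u(2) v(2) length_lsteps[OF u(1)] length_lsteps[OF v(1)] by (auto elim!: cancel.cases)
    have "lstep\<^sup>*\<^sup>* u v" using lsteps_sym[OF u(1)] v(1) by (rule rtranclp_trans)
    then obtain d where d: "step\<^sup>*\<^sup>* a' d" "step\<^sup>*\<^sup>* b' d"
      using local_confluence u(2) v(2) by blast
    obtain d1 where d1: "step\<^sup>*\<^sup>* a d1" "step\<^sup>*\<^sup>* d d1"
      using less.hyps[OF len(1) u(3) d(1)] by blast
    obtain d2 where "step\<^sup>*\<^sup>* b d2" "step\<^sup>*\<^sup>* d1 d2"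
      using less.hyps[OF len(2) v(3) rtranclp_trans[OF d(2) d1(2)]] by blast
    with rtranclp_trans[OF d1(1)] show ?thesis by blast
  qed
qed

lemma conv_joinable: "conv u v \<Longrightarrow> \<exists>d. step\<^sup>*\<^sup>* u d \<and> step\<^sup>*\<^sup>* v d"
proof (induction rule: rtranclp_induct)
  case (step y z)
  then obtain d where d: "step\<^sup>*\<^sup>* u d" "step\<^sup>*\<^sup>* y d" by blast
  from step(2) show ?case
  proof
    assume "step y z"
    then obtain d' where "step\<^sup>*\<^sup>* d d'" "step\<^sup>*\<^sup>* z d'"
      using confluence[OF d(2)] by blast
    then show ?thesis using rtranclp_trans[OF d(1)] by blast
  next
    assume "step z y"
    then show ?thesis using d converse_rtranclp_into_rtranclp[of step z y d] by blast
  qed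
qed auto

lemma conv_rotate: "conv (u @ v) (v @ u)"
  by (intro steps_conv shuffles_steps rotate)

section \<open>Moves through words of bounded length\<close>

text \<open>Insertions are included so that a cancellation can be traversed backwards; flips are
  absent because they can be simulated.\<close>

definition rules :: "'v set \<Rightarrow> ('v letter list \<times> 'v letter list) set" where
  "rules V = {([(a, e), (b, f)], [(b, f \<noteq> tw a b), (a, e \<noteq> tw b a)]) | a b e f. adj a b}
     \<union> {([(a, e), (a, \<not> e)], []) | a e. a \<in> V} \<union> {([], [(a, e), (a, \<not> e)]) | a e. a \<in> V}"

definition move :: "'v set \<Rightarrow> 'v letter list \<Rightarrow> 'v letter list \<Rightarrow> bool" where
  "move V w w' \<longleftrightarrow> w' = rotate1 w \<or> (\<exists>lr\<in>rules V. w' = apply_rule lr w)"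

definition bmove :: "'v set \<Rightarrow> nat \<Rightarrow> 'v letter list \<Rightarrow> 'v letter list \<Rightarrow> bool" where
  "bmove V B w w' \<longleftrightarrow> move V w w' \<and> w \<in> lists (letters V) \<and> w' \<in> lists (letters V)
     \<and> length w \<le> B \<and> length w' \<le> B"

lemma rules_words:
  assumes "\<forall>a b. adj a b \<longrightarrow> a \<in> V"
  shows "rules V \<subseteq> {l \<in> lists (letters V). length l \<le> 2} \<times> {r \<in> lists (letters V). length r \<le> 2}"
  using assms adj_sym unfolding rules_def letters_def by fastforce

lemma finite_rules:
  assumes "\<forall>a b. adj a b \<longrightarrow> a \<in> V" "finite V"
  shows "finite (rules V)"
proof -
  have "finite {l \<in> lists (letters V). length l \<le> 2}"
    using finite_lists_length_le[of "letters V" 2] assms(2)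
    by (auto simp: letters_def lists_eq_set elim: rev_finite_subset)
  then show ?thesis using rules_words[OF assms(1)] by (meson finite_SigmaI finite_subset)
qed

lemma apply_rule_prefix: "apply_rule (l, r) (l @ w) = r @ w"
  by (simp add: apply_rule_def)

lemma move_rule: "(l, r) \<in> rules V \<Longrightarrow> move V (l @ w) (r @ w)"
  unfolding move_def using apply_rule_prefix[of l r w] by metis

lemma move_words:
  assumes "\<forall>a b. adj a b \<longrightarrow> a \<in> V" and "move V w w'" and "w \<in> lists (letters V)"
  shows "w' \<in> lists (letters V)"
  using assms(2) unfolding move_def
proof
  assume "\<exists>lr\<in>rules V. w' = apply_rule lr w"
  then obtain l r where "(l, r) \<in> rules V" "w' = apply_rule (l, r) w" by auto
  with rules_words[OF assms(1)] assms(3) show ?thesis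
    by (auto simp: apply_rule_def in_lists_conv_set dest!: in_set_dropD)
qed (use assms(3) in auto)

context
  fixes V :: "'v set"
  assumes adj_V: "\<forall>a b. adj a b \<longrightarrow> a \<in> V"
begin

lemma shuffle_bmove:
  assumes "shuffle w w'" "w \<in> lists (letters V)" "length w \<le> B"
  shows "bmove V B w w'"
proof -
  have "move V w w'" using assms(1)
  proof cases
    case (swap a b e f r)
    then have "([(a, e), (b, f)], [(b, f \<noteq> tw a b), (a, e \<noteq> tw b a)]) \<in> rules V"
      unfolding rules_def by blast
    from move_rule[OF this, of r] show ?thesis using swap by simp
  next
    case (rot x r)
    then show ?thesis by (simp add: move_def)
  qed
  then show ?thesis
    using assms move_words[OF adj_V] length_shuffle by (auto simp: bmove_def)
qed

lemma shuffles_bmoves: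
  assumes "shuffle\<^sup>*\<^sup>* w w'" "w \<in> lists (letters V)" "length w \<le> B"
  shows "(bmove V B)\<^sup>*\<^sup>* w w' \<and> w' \<in> lists (letters V) \<and> length w' \<le> B"
  using assms
proof (induction rule: rtranclp_induct)
  case (step y z)
  then have "bmove V B y z" by (auto intro: shuffle_bmove)
  then show ?case using step by (auto simp: bmove_def intro: rtranclp.rtrancl_into_rtrancl)
qed simp

text \<open>A flip is simulated by inserting a cancelling pair and moving one of its letters once
  around the cyclic word; this is where the two additional letters are needed.\<close>

lemma flip_bmoves:
  assumes "past a w" "\<not> par a w" "w \<in> lists (letters V)" "length w + 2 \<le> B"
  shows "(bmove V B)\<^sup>*\<^sup>* w (flip a w) \<and> flip a w \<in> lists (letters V)"
proof (cases w)
  case Nil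
  then show ?thesis by simp
next
  case (Cons x w0)
  then have a: "a \<in> V" using assms(1) adj_V by auto
  have W: "(a, e) \<in> letters V" for e using a by (simp add: letters_def)
  have rules: "([], [(a, True), (a, False)]) \<in> rules V" "([(a, False), (a, True)], []) \<in> rules V"
    using a unfolding rules_def by force+
  have "bmove V B w ((a, True) # (a, False) # w)"
    using move_rule[OF rules(1), of w] assms W by (simp add: bmove_def)
  moreover have "shuffle\<^sup>*\<^sup>* ((a, True) # (a, False) # w) ((a, True) # flip a w @ [(a, False)])"
    using move_past[OF assms(1), of "[(a, True)]" False "[]"] assms(2) by simp
  then have "shuffle\<^sup>*\<^sup>* ((a, True) # (a, False) # w) ((a, False) # (a, True) # flip a w)"
    using rotate[of "(a, True) # flip a w" "[(a, False)]"] by simp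
  from shuffles_bmoves[OF this] have
    "(bmove V B)\<^sup>*\<^sup>* ((a, True) # (a, False) # w) ((a, False) # (a, True) # flip a w)"
    "(a, False) # (a, True) # flip a w \<in> lists (letters V)"
    using assms W by auto
  moreover from this(2) have "bmove V B ((a, False) # (a, True) # flip a w) (flip a w)"
    using move_rule[OF rules(2), of "flip a w"] assms by (simp add: bmove_def)
  ultimately show ?thesis
    by (meson bmove_def converse_rtranclp_into_rtranclp rtranclp.rtrancl_into_rtrancl)
qed

text \<open>Both directions are needed, since a path between conjugate words first descends and then
  climbs. The room of two letters persists because no step lengthens the word.\<close>

lemma step_bmoves:
  assumes "step w w'" "w \<in> lists (letters V)" "length w + 2 \<le> B"
  shows "(bmove V B)\<^sup>*\<^sup>* w w' \<and> (bmove V B)\<^sup>*\<^sup>* w' w \<and> w' \<in> lists (letters V) \<and> length w' + 2 \<le> B"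
proof -
  from assms(1) consider "shuffle w w'" | a where "past a w" "\<not> par a w" "w' = flip a w" | "cancel w w'"
    unfolding step_def by (auto elim: lstep.cases)
  then show ?thesis
  proof cases
    case 1
    then have b: "bmove V B w w'" using assms by (intro shuffle_bmove) auto
    moreover have "(bmove V B)\<^sup>*\<^sup>* w' w"
      using shuffles_bmoves[OF shuffle_sym[OF 1]] b by (auto simp: bmove_def)
    ultimately show ?thesis using length_shuffle[OF 1] assms by (auto simp: bmove_def)
  next
    case 2
    have f: "(bmove V B)\<^sup>*\<^sup>* w (flip a w) \<and> flip a w \<in> lists (letters V)"
      using 2 assms by (intro flip_bmoves)
    moreover have "(bmove V B)\<^sup>*\<^sup>* (flip a w) (flip a (flip a w))"
      using 2 assms f flip_bmoves[of a "flip a w"] by simp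
    ultimately show ?thesis using 2 assms by simp
  next
    case 3
    then obtain a e where w: "w = (a, e) # (a, \<not> e) # w'" by (auto elim: cancel.cases)
    have "a \<in> V" using assms(2) w by (simp add: letters_def)
    then have "([(a, e), (a, \<not> e)], []) \<in> rules V" "([], [(a, e), (a, \<not> e)]) \<in> rules V"
      unfolding rules_def by blast+
    from this[THEN move_rule, of w'] have "bmove V B w w'" "bmove V B w' w"
      using w assms by (auto simp: bmove_def)
    then show ?thesis using w assms by auto
  qed
qed

lemma steps_bmoves:
  assumes "step\<^sup>*\<^sup>* w w'" "w \<in> lists (letters V)" "length w + 2 \<le> B"
  shows "(bmove V B)\<^sup>*\<^sup>* w w' \<and> (bmove V B)\<^sup>*\<^sup>* w' w \<and> w' \<in> lists (letters V) \<and> length w' + 2 \<le> B"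
  using assms
proof (induction rule: rtranclp_induct)
  case (step y z)
  then show ?case using step_bmoves[of y z B] by (meson rtranclp_trans)
qed simp

text \<open>Both words descend to a common word, and one descent is run backwards. The sum of the
  lengths serves as a symmetric upper bound for both; the 2 is the room for flips.\<close>

lemma conv_bmoves:
  assumes "conv u v" "u \<in> lists (letters V)" "v \<in> lists (letters V)"
  shows "(bmove V (length u + length v + 2))\<^sup>*\<^sup>* u v"
proof -
  let ?B = "length u + length v + 2"
  from conv_joinable[OF assms(1)] obtain d where d: "step\<^sup>*\<^sup>* u d" "step\<^sup>*\<^sup>* v d" by blast
  have "(bmove V ?B)\<^sup>*\<^sup>* u d" "(bmove V ?B)\<^sup>*\<^sup>* d v"
    using steps_bmoves[OF d(1) assms(2), of ?B] steps_bmoves[OF d(2) assms(3), of ?B] by auto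
  then show ?thesis by (rule rtranclp_trans)
qed

end

end

section \<open>Conjugacy in twisted right-angled Artin groups\<close>

definition sgn_pow :: "('a, 'b) monoid_scheme \<Rightarrow> bool \<Rightarrow> 'a \<Rightarrow> 'a" where
  "sgn_pow G e x = (if e then x else inv\<^bsub>G\<^esub> x)"

lemma (in group) commute_inv_left:
  assumes "x \<in> carrier G" "y \<in> carrier G" "z \<in> carrier G" "x \<otimes> y = y \<otimes> z"
  shows "inv x \<otimes> y = y \<otimes> inv z"
proof -
  have "y \<otimes> inv z = inv x \<otimes> (x \<otimes> y) \<otimes> inv z" using assms(1-3) by (simp add: m_assoc[symmetric])
  also have "\<dots> = inv x \<otimes> (y \<otimes> z) \<otimes> inv z" by (simp only: assms(4))
  also have "\<dots> = inv x \<otimes> y" using assms(1-3) by (simp add: m_assoc)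
  finally show ?thesis by simp
qed

lemma (in group) commute_inv_right:
  assumes "x \<in> carrier G" "y \<in> carrier G" "z \<in> carrier G" "z \<otimes> y = y \<otimes> x"
  shows "x \<otimes> inv y = inv y \<otimes> z"
proof -
  have "inv y \<otimes> z = inv y \<otimes> (z \<otimes> y) \<otimes> inv y" using assms(1-3) by (simp add: m_assoc)
  also have "\<dots> = inv y \<otimes> (y \<otimes> x) \<otimes> inv y" by (simp only: assms(4))
  also have "\<dots> = x \<otimes> inv y" using assms(1-3) by (simp add: m_assoc[symmetric])
  finally show ?thesis by simp
qed

text \<open>Both kinds of defining relation say that \<open>x \<otimes> y\<close> equals
  \<open>y\<close> times \<open>x\<close> or its inverse. This single form, known for positive
  letters, is transferred to all four sign patterns.\<close>

lemma (in group) sgn_pow_commute: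
  assumes "x \<in> carrier G" "y \<in> carrier G" "x \<otimes> y = y \<otimes> sgn_pow G s x"
  shows "sgn_pow G e x \<otimes> sgn_pow G f y = sgn_pow G f y \<otimes> sgn_pow G (e = s) x"
proof -
  have pos: "sgn_pow G e x \<otimes> y = y \<otimes> sgn_pow G (e = s) x" for e
    using assms commute_inv_left[of x y "sgn_pow G s x"] by (auto simp: sgn_pow_def split: if_splits)
  show ?thesis
  proof (cases f)
    case True
    then show ?thesis using pos by (simp add: sgn_pow_def)
  next
    case False
    have "sgn_pow G (e = s) x \<otimes> y = y \<otimes> sgn_pow G e x" using pos[of "e = s"] by (cases s) auto
    then show ?thesis
      using False assms commute_inv_right[of "sgn_pow G e x" y "sgn_pow G (e = s) x"]
      by (simp add: sgn_pow_def)
  qed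
qed

definition graph_adj :: "'v mixed_graph \<Rightarrow> 'v \<Rightarrow> 'v \<Rightarrow> bool" where
  "graph_adj \<Gamma> a b \<longleftrightarrow> {a, b} \<in> edges \<Gamma>"

text \<open>The relation \<open>a b a = b\<close> turns \<open>a b\<close> into \<open>b\<close>
  followed by the inverse of \<open>a\<close>: passing the terminus inverts the origin, so the
  origin is the second argument.\<close>

definition graph_tw :: "'v mixed_graph \<Rightarrow> 'v \<Rightarrow> 'v \<Rightarrow> bool" where
  "graph_tw \<Gamma> a b \<longleftrightarrow> (\<exists>e\<in>dir_edges \<Gamma>. origin \<Gamma> e = b \<and> terminus \<Gamma> e = a)"

lemma (in group) conjugate_in_refl: "x \<in> carrier G \<Longrightarrow> conjugate_in G x x"
  unfolding conjugate_in_def by (intro bexI[of _ \<one>]) auto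

lemma (in group) conjugate_in_trans:
  assumes "x \<in> carrier G" "conjugate_in G x y" "conjugate_in G y z"
  shows "conjugate_in G x z"
proof -
  from assms obtain g h where "g \<in> carrier G" "h \<in> carrier G" "y = g \<otimes> x \<otimes> inv g" "z = h \<otimes> y \<otimes> inv h"
    unfolding conjugate_in_def by auto
  then show ?thesis
    unfolding conjugate_in_def using assms(1)
    by (intro bexI[of _ "h \<otimes> g"]) (simp_all add: inv_mult_group m_assoc)
qed

context
  fixes \<Gamma> :: "'v mixed_graph"
  assumes mixed: "mixed_graph \<Gamma>"
begin

interpretation twisting "graph_adj \<Gamma>" "graph_tw \<Gamma>"
proof
  show "graph_adj \<Gamma> a b \<Longrightarrow> graph_adj \<Gamma> b a" for a b
    by (simp add: graph_adj_def insert_commute)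
  show "\<not> graph_adj \<Gamma> a a" for a
    using mixed by (fastforce simp: graph_adj_def mixed_graph_def)
qed

interpretation group "traag \<Gamma>" using mixed by (rule group_traag)

lemma graph_adj_verts: "\<forall>a b. graph_adj \<Gamma> a b \<longrightarrow> a \<in> verts \<Gamma>"
  using mixed by (auto simp: graph_adj_def mixed_graph_def)

lemma graph_adj_verts2: "graph_adj \<Gamma> a b \<Longrightarrow> b \<in> verts \<Gamma>"
  using mixed by (auto simp: graph_adj_def mixed_graph_def)

lemma graph_tw_asym: "graph_tw \<Gamma> a b \<Longrightarrow> \<not> graph_tw \<Gamma> b a"
proof
  assume "graph_tw \<Gamma> a b" "graph_tw \<Gamma> b a"
  then obtain e e' where e: "e \<in> dir_edges \<Gamma>" "origin \<Gamma> e = b" "terminus \<Gamma> e = a"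
    "e' \<in> dir_edges \<Gamma>" "origin \<Gamma> e' = a" "terminus \<Gamma> e' = b"
    unfolding graph_tw_def by auto
  with mixed have "e = {a, b}" "e' = {a, b}" "card e = 2" by (auto simp: mixed_graph_def)
  with e show False by auto
qed

lemma graph_tw_iff_directed:
  assumes "graph_adj \<Gamma> a b"
  shows "{a, b} \<in> dir_edges \<Gamma> \<longleftrightarrow> graph_tw \<Gamma> a b \<or> graph_tw \<Gamma> b a"
proof
  assume e: "{a, b} \<in> dir_edges \<Gamma>"
  with mixed have "{origin \<Gamma> {a, b}, terminus \<Gamma> {a, b}} = {a, b}" by (auto simp: mixed_graph_def)
  with e show "graph_tw \<Gamma> a b \<or> graph_tw \<Gamma> b a"
    unfolding graph_tw_def by (auto simp: doubleton_eq_iff)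
next
  assume "graph_tw \<Gamma> a b \<or> graph_tw \<Gamma> b a"
  then obtain e where "e \<in> dir_edges \<Gamma>" "{origin \<Gamma> e, terminus \<Gamma> e} = {a, b}"
    unfolding graph_tw_def by (auto simp: insert_commute)
  with mixed show "{a, b} \<in> dir_edges \<Gamma>" by (auto simp: mixed_graph_def)
qed

section \<open>Words as elements of the group\<close>

lemma traag_elem_append:
  "u \<in> lists (letters (verts \<Gamma>)) \<Longrightarrow> v \<in> lists (letters (verts \<Gamma>)) \<Longrightarrow>
    traag_elem \<Gamma> (u @ v) = traag_elem \<Gamma> u \<otimes>\<^bsub>traag \<Gamma>\<^esub> traag_elem \<Gamma> v"
  unfolding traag_def traag_elem_def by (rule word_class_mult[OF traag_rels_words[OF mixed], symmetric])

lemma traag_elem_Nil: "traag_elem \<Gamma> [] = \<one>\<^bsub>traag \<Gamma>\<^esub>"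
  by (simp add: traag_def traag_elem_def presented_group_def)

lemma traag_elem_eq_iff:
  assumes "u \<in> lists (letters (verts \<Gamma>))" "v \<in> lists (letters (verts \<Gamma>))"
  shows "traag_elem \<Gamma> u = traag_elem \<Gamma> v \<longleftrightarrow> (u, v) \<in> pres_eq (verts \<Gamma>) (traag_rels \<Gamma>)"
  unfolding traag_elem_def word_class_def
  using eq_equiv_class_iff[OF equiv_pres_eq[OF traag_rels_words[OF mixed]] assms] .

lemma traag_elem_eqI:
  "(u, v) \<in> pres_eq (verts \<Gamma>) (traag_rels \<Gamma>) \<Longrightarrow> traag_elem \<Gamma> u = traag_elem \<Gamma> v"
  using traag_elem_eq_iff pres_eq_words[OF traag_rels_words[OF mixed]] by blast

lemma letter_carrier: "a \<in> verts \<Gamma> \<Longrightarrow> traag_elem \<Gamma> [(a, e)] \<in> carrier (traag \<Gamma>)"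
  by (intro traag_elem_carrier) (simp add: letters_def)

lemma traag_elem_two:
  "a \<in> verts \<Gamma> \<Longrightarrow> b \<in> verts \<Gamma> \<Longrightarrow>
    traag_elem \<Gamma> [(a, e), (b, f)] = traag_elem \<Gamma> [(a, e)] \<otimes>\<^bsub>traag \<Gamma>\<^esub> traag_elem \<Gamma> [(b, f)]"
  using traag_elem_append[of "[(a, e)]" "[(b, f)]"] by (simp add: letters_def)

lemma traag_elem_cancel: "a \<in> verts \<Gamma> \<Longrightarrow> traag_elem \<Gamma> [(a, e), (a, \<not> e)] = traag_elem \<Gamma> []"
  by (intro traag_elem_eqI pres_cancel)

lemma traag_elem_letter:
  assumes "a \<in> verts \<Gamma>"
  shows "traag_elem \<Gamma> [(a, e)] = sgn_pow (traag \<Gamma>) e (traag_elem \<Gamma> [(a, True)])"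
proof (cases e)
  case False
  have "traag_elem \<Gamma> [(a, False)] \<otimes>\<^bsub>traag \<Gamma>\<^esub> traag_elem \<Gamma> [(a, True)] = \<one>\<^bsub>traag \<Gamma>\<^esub>"
    using traag_elem_cancel[OF assms, of False] traag_elem_two[OF assms assms, of False True]
    by (simp add: traag_elem_Nil)
  then have "inv\<^bsub>traag \<Gamma>\<^esub> traag_elem \<Gamma> [(a, True)] = traag_elem \<Gamma> [(a, False)]"
    using assms by (intro inv_equality letter_carrier)
  with False show ?thesis by (simp add: sgn_pow_def)
qed (simp add: sgn_pow_def)

lemma swap_directed:
  assumes "graph_tw \<Gamma> b a"
  shows "traag_elem \<Gamma> [(a, e), (b, f)] = traag_elem \<Gamma> [(b, f), (a, \<not> e)]"
proof -
  from assms obtain d where d: "d \<in> dir_edges \<Gamma>" "origin \<Gamma> d = a" "terminus \<Gamma> d = b"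
    unfolding graph_tw_def by auto
  with mixed have V: "a \<in> verts \<Gamma>" "b \<in> verts \<Gamma>" by (fastforce simp: mixed_graph_def)+
  define x where "x = traag_elem \<Gamma> [(a, True)]"
  define y where "y = traag_elem \<Gamma> [(b, True)]"
  have c: "x \<in> carrier (traag \<Gamma>)" "y \<in> carrier (traag \<Gamma>)"
    using V letter_carrier by (auto simp: x_def y_def)
  have "traag_elem \<Gamma> ([(a, True), (b, True)] @ [(a, True)]) = y"
    unfolding y_def append.simps
    using d by (intro traag_elem_eqI pres_rel) (auto simp: traag_rels_def)
  moreover have "traag_elem \<Gamma> ([(a, True), (b, True)] @ [(a, True)]) = x \<otimes>\<^bsub>traag \<Gamma>\<^esub> y \<otimes>\<^bsub>traag \<Gamma>\<^esub> x"
    unfolding x_def y_def using V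
    by (subst traag_elem_append) (auto simp: letters_def traag_elem_two)
  ultimately have "x \<otimes>\<^bsub>traag \<Gamma>\<^esub> y = y \<otimes>\<^bsub>traag \<Gamma>\<^esub> sgn_pow (traag \<Gamma>) False x"
    using c by (simp add: sgn_pow_def inv_solve_right)
  from sgn_pow_commute[OF c this, of e f] show ?thesis
    using V by (simp add: traag_elem_two traag_elem_letter[of a e] traag_elem_letter[of a "\<not> e"]
        traag_elem_letter[of b f] x_def y_def)
qed

lemma swap_undirected:
  assumes "graph_adj \<Gamma> a b" "\<not> graph_tw \<Gamma> a b" "\<not> graph_tw \<Gamma> b a"
  shows "traag_elem \<Gamma> [(a, e), (b, f)] = traag_elem \<Gamma> [(b, f), (a, e)]"
proof -
  have V: "a \<in> verts \<Gamma>" "b \<in> verts \<Gamma>" using assms(1) graph_adj_verts graph_adj_verts2 by auto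
  define x where "x = traag_elem \<Gamma> [(a, True)]"
  define y where "y = traag_elem \<Gamma> [(b, True)]"
  have c: "x \<in> carrier (traag \<Gamma>)" "y \<in> carrier (traag \<Gamma>)"
    using V letter_carrier by (auto simp: x_def y_def)
  have "traag_elem \<Gamma> [(a, True), (b, True)] = traag_elem \<Gamma> [(b, True), (a, True)]"
    using assms graph_tw_iff_directed[OF assms(1)]
    by (intro traag_elem_eqI pres_rel) (auto simp: traag_rels_def graph_adj_def)
  then have "x \<otimes>\<^bsub>traag \<Gamma>\<^esub> y = y \<otimes>\<^bsub>traag \<Gamma>\<^esub> sgn_pow (traag \<Gamma>) True x"
    using V by (simp add: sgn_pow_def x_def y_def traag_elem_two)
  from sgn_pow_commute[OF c this, of e f] show ?thesis
    using V by (simp add: traag_elem_two traag_elem_letter[of a e] traag_elem_letter[of b f] x_def y_def)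
qed

lemma traag_elem_rule:
  assumes "(l, r) \<in> rules (verts \<Gamma>)"
  shows "traag_elem \<Gamma> l = traag_elem \<Gamma> r"
proof -
  consider a b e f where "l = [(a, e), (b, f)]" "r = [(b, f \<noteq> graph_tw \<Gamma> a b), (a, e \<noteq> graph_tw \<Gamma> b a)]"
      "graph_adj \<Gamma> a b"
    | a e where "a \<in> verts \<Gamma>" "l = [(a, e), (a, \<not> e)] \<and> r = [] \<or> l = [] \<and> r = [(a, e), (a, \<not> e)]"
    using assms unfolding rules_def by blast
  then show ?thesis
  proof cases
    case 1
    consider "graph_tw \<Gamma> b a" | "graph_tw \<Gamma> a b" | "\<not> graph_tw \<Gamma> a b" "\<not> graph_tw \<Gamma> b a" by blast
    then show ?thesis
    proof cases
      case 1
      then show ?thesis using swap_directed[OF 1, of e f] graph_tw_asym[OF 1]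
          \<open>l = _\<close> \<open>r = _\<close> by simp
    next
      case 2
      \<comment> \<open>The edge points the other way, so the swap equation is read from right to
        left, with the sign of \<open>b\<close> inverted beforehand.\<close>
      then show ?thesis using swap_directed[OF 2, of "\<not> f" e] graph_tw_asym[OF 2]
          \<open>l = _\<close> \<open>r = _\<close> by simp
    next
      case 3
      then show ?thesis using swap_undirected[OF \<open>graph_adj \<Gamma> a b\<close> 3, of e f] \<open>l = _\<close> \<open>r = _\<close> by simp
    qed
  next
    case 2
    then show ?thesis using traag_elem_cancel[of a e] by auto
  qed
qed

section \<open>Moves versus conjugacy\<close>

lemma move_conjugate:
  assumes "move (verts \<Gamma>) w w'" "w \<in> lists (letters (verts \<Gamma>))"
  shows "conjugate_in (traag \<Gamma>) (traag_elem \<Gamma> w) (traag_elem \<Gamma> w')"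
  using assms(1) unfolding move_def
proof
  assume w': "w' = rotate1 w"
  show ?thesis
  proof (cases w)
    case Nil
    then show ?thesis
      using w' conjugate_in_refl by (simp add: traag_elem_Nil)
  next
    case (Cons x r)
    define X where "X = traag_elem \<Gamma> [x]"
    define R where "R = traag_elem \<Gamma> r"
    have c: "X \<in> carrier (traag \<Gamma>)" "R \<in> carrier (traag \<Gamma>)"
      using assms(2) Cons by (auto simp: X_def R_def intro!: traag_elem_carrier)
    have "traag_elem \<Gamma> w = X \<otimes>\<^bsub>traag \<Gamma>\<^esub> R" "traag_elem \<Gamma> w' = R \<otimes>\<^bsub>traag \<Gamma>\<^esub> X"
      using traag_elem_append[of "[x]" r] traag_elem_append[of r "[x]"] assms(2) Cons w'
      by (simp_all add: X_def R_def)
    \<comment> \<open>Rotating \<open>x\<close> to the end is conjugation by its inverse.\<close>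
    then show ?thesis unfolding conjugate_in_def
      using c by (intro bexI[of _ "inv\<^bsub>traag \<Gamma>\<^esub> X"]) (simp_all add: m_assoc[symmetric])
  qed
next
  assume "\<exists>lr\<in>rules (verts \<Gamma>). w' = apply_rule lr w"
  then obtain l r where lr: "(l, r) \<in> rules (verts \<Gamma>)" "w' = apply_rule (l, r) w" by auto
  have "traag_elem \<Gamma> w' = traag_elem \<Gamma> w"
  proof (cases "take (length l) w = l")
    case True
    then obtain q where q: "w = l @ q" by (metis append_take_drop_id)
    have "l \<in> lists (letters (verts \<Gamma>))" "r \<in> lists (letters (verts \<Gamma>))" "q \<in> lists (letters (verts \<Gamma>))"
      using rules_words[OF graph_adj_verts] lr(1) assms(2) q by auto
    then show ?thesis
      using lr q traag_elem_rule[OF lr(1)] by (simp add: apply_rule_prefix traag_elem_append)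
  qed (use lr in \<open>simp add: apply_rule_def\<close>)
  then show ?thesis
    using conjugate_in_refl[OF traag_elem_carrier[OF assms(2)]] by simp
qed

text \<open>\<open>conv\<close> amounts to conjugacy and is no congruence, so the remainder
  \<open>q\<close> is kept arbitrary: in the context case a rotation makes the left factor
  \<open>p\<close> a part of it.\<close>

lemma conv_pres_eq:
  "(u, v) \<in> pres_eq (verts \<Gamma>) (traag_rels \<Gamma>) \<Longrightarrow> conv (u @ q) (v @ q)"
proof (induction arbitrary: q rule: pres_eq.induct)
  case (pres_cancel a e)
  then show ?case using steps_conv[OF cancel_inside[of "[]" a e q]] by simp
next
  case (pres_rel l r)
  then consider a b where "l = [(a, True), (b, True)]" "r = [(b, True), (a, True)]"
      "{a, b} \<in> edges \<Gamma> - dir_edges \<Gamma>"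
    | a b e where "l = [(a, True), (b, True), (a, True)]" "r = [(b, True)]"
      "e \<in> dir_edges \<Gamma>" "origin \<Gamma> e = a" "terminus \<Gamma> e = b"
    unfolding traag_rels_def by auto
  then show ?case
  proof cases
    case 1
    then have adj: "graph_adj \<Gamma> a b" by (simp add: graph_adj_def)
    then show ?thesis
      using 1 graph_tw_iff_directed[OF adj] steps_conv[OF shuffles_steps[OF swap_inside[OF adj, of "[]" True True q]]]
      by simp
  next
    case 2
    then have tw: "graph_tw \<Gamma> b a" by (auto simp: graph_tw_def)
    have "e = {a, b}" "e \<in> edges \<Gamma>" using 2 mixed by (auto simp: mixed_graph_def)
    then have adj: "graph_adj \<Gamma> a b" by (simp add: graph_adj_def)
    \<comment> \<open>One swap turns \<open>a b a\<close> into \<open>b\<close> followed by a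
      cancelling pair on \<open>a\<close>.\<close>
    have "shuffle\<^sup>*\<^sup>* (l @ q) ((b, True) # (a, False) # (a, True) # q)"
      using swap_inside[OF adj, of "[]" True True "(a, True) # q"] 2 tw graph_tw_asym[OF tw] by simp
    then have "step\<^sup>*\<^sup>* (l @ q) ((b, True) # (a, False) # (a, True) # q)" by (rule shuffles_steps)
    moreover have "step\<^sup>*\<^sup>* ((b, True) # (a, False) # (a, True) # q) (r @ q)"
      using cancel_inside[of "[(b, True)]" a False q] 2 by simp
    ultimately show ?thesis by (intro steps_conv) (rule rtranclp_trans)
  qed
next
  case (pres_sym u v)
  show ?case by (rule conv_sym) (rule pres_sym.IH)
next
  case (pres_trans u v w)
  then show ?case by (meson rtranclp_trans)
next
  case (pres_context u v p q')
  have "conv ((p @ u @ q') @ q) (u @ q' @ q @ p)" using conv_rotate[of p "u @ q' @ q"] by simp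
  also have "conv \<dots> (v @ q' @ q @ p)" using pres_context(4)[of "q' @ q @ p"] .
  also have "conv \<dots> ((p @ v @ q') @ q)" using conv_rotate[of "v @ q' @ q" p] by simp
  finally show ?case .
qed simp

text \<open>\<open>v\<close> represents the same element as \<open>g u g'\<close>; rotating
  \<open>g'\<close> to the front creates the trivial factor \<open>g' g\<close>, which can be
  removed.\<close>

lemma conjugate_conv:
  assumes u: "u \<in> lists (letters (verts \<Gamma>))" and v: "v \<in> lists (letters (verts \<Gamma>))"
    and conj: "conjugate_in (traag \<Gamma>) (traag_elem \<Gamma> u) (traag_elem \<Gamma> v)"
  shows "conv u v"
proof -
  from conj obtain x where x: "x \<in> carrier (traag \<Gamma>)"
    "traag_elem \<Gamma> v = x \<otimes>\<^bsub>traag \<Gamma>\<^esub> traag_elem \<Gamma> u \<otimes>\<^bsub>traag \<Gamma>\<^esub> inv\<^bsub>traag \<Gamma>\<^esub> x"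
    unfolding conjugate_in_def by auto
  then obtain g where g: "g \<in> lists (letters (verts \<Gamma>))" "x = traag_elem \<Gamma> g"
    unfolding traag_def traag_elem_def by (auto elim: presented_group_cases)
  obtain g' where g': "g' \<in> lists (letters (verts \<Gamma>))"
    "(g' @ g, []) \<in> pres_eq (verts \<Gamma>) (traag_rels \<Gamma>)"
    using word_inverse[OF traag_rels_words[OF mixed] g(1)] by blast
  have "traag_elem \<Gamma> g' \<otimes>\<^bsub>traag \<Gamma>\<^esub> x = \<one>\<^bsub>traag \<Gamma>\<^esub>"
    using traag_elem_eqI[OF g'(2)] g g' by (simp add: traag_elem_append traag_elem_Nil)
  then have "inv\<^bsub>traag \<Gamma>\<^esub> x = traag_elem \<Gamma> g'"
    using x(1) traag_elem_carrier[OF g'(1)] by (intro inv_equality)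
  then have "traag_elem \<Gamma> v = traag_elem \<Gamma> ((g @ u) @ g')"
    using x(2) g g'(1) u by (simp only: traag_elem_append append_in_lists_conv simp_thms)
  then have "(v, (g @ u) @ g') \<in> pres_eq (verts \<Gamma>) (traag_rels \<Gamma>)"
    using v g g'(1) u by (simp add: traag_elem_eq_iff)
  from conv_sym[OF conv_pres_eq[OF this, of "[]"]] have "conv (g @ u @ g') v" by simp
  moreover have "conv (g' @ g @ u) (g @ u @ g')" using conv_rotate[of g' "g @ u"] by simp
  moreover have "conv u (g' @ g @ u)"
    using conv_sym[OF conv_pres_eq[OF g'(2), of u]] by simp
  ultimately show ?thesis by (meson rtranclp_trans)
qed

section \<open>Reduction to bounded reachability\<close>

theorem conjugacy_decidable:
  assumes fin: "finite (verts \<Gamma>)"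
  shows "decidable_word_rel (letters (verts \<Gamma>))
           (\<lambda>u v. conjugate_in (traag \<Gamma>) (traag_elem \<Gamma> u) (traag_elem \<Gamma> v))"
  unfolding decidable_word_rel_def
proof (intro conjI allI impI)
  show finL: "finite (letters (verts \<Gamma>))" using fin by (simp add: letters_def)
  fix c :: "'v letter \<Rightarrow> nat"
  assume inj: "inj_on c (letters (verts \<Gamma>))"
  let ?V = "verts \<Gamma>" and ?W = "lists (letters (verts \<Gamma>))"
  define enc where "enc = (\<lambda>w. list_encode (map c w))"
  obtain K where K: "\<And>x. x \<in> letters ?V \<Longrightarrow> c x \<le> K"
    using finL finite_nat_set_iff_bounded_le[of "c ` letters ?V"] by auto
  obtain Rl where Rl: "set Rl = rules ?V"
    using finite_list[OF finite_rules[OF graph_adj_verts fin]] by blast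
  define rule_fun where "rule_fun = (\<lambda>(l, r) n. list_encode (apply_rule (map c l, map c r) (list_decode n)))"
  define hs where "hs = (\<lambda>n. list_encode (rotate1 (list_decode n))) # map rule_fun Rl"
  have inj_map: "map c w = map c w' \<longleftrightarrow> w = w'" if "w \<in> ?W" "w' \<in> ?W" for w w'
    using inj_on_map_eq_map[of c w w'] that inj by (auto intro: inj_on_subset)
  have enc_rule: "rule_fun (l, r) (enc w) = enc (apply_rule (l, r) w)"
    if "(l, r) \<in> rules ?V" "w \<in> ?W" for l r w
  proof -
    \<comment> \<open>The numbering \<open>c\<close> is injective only on the alphabet, so a match
      of codes is a match of words only when both words are over it.\<close>
    have "l \<in> ?W" "take (length l) w \<in> ?W"
      using rules_words[OF graph_adj_verts] that by (auto dest: in_set_takeD)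
    from inj_map[OF this(2,1)] show ?thesis
      by (auto simp: rule_fun_def enc_def apply_rule_def take_map drop_map)
  qed
  have graph: "(enc w, y) \<in> graph_of hs \<longleftrightarrow> (\<exists>w'. move ?V w w' \<and> y = enc w')" if "w \<in> ?W" for w y
  proof -
    have "(enc w, y) \<in> graph_of hs \<longleftrightarrow> (\<exists>h\<in>set hs. y = h (enc w))"
      unfolding graph_of_def by blast
    also have "\<dots> \<longleftrightarrow> y = enc (rotate1 w) \<or> (\<exists>lr\<in>rules ?V. y = rule_fun lr (enc w))"
      by (simp add: hs_def Rl enc_def rotate1_map)
    also have "(\<exists>lr\<in>rules ?V. y = rule_fun lr (enc w)) \<longleftrightarrow> (\<exists>lr\<in>rules ?V. y = enc (apply_rule lr w))"
      by (rule bex_cong[OF refl]) (use enc_rule[OF _ that] in auto)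
    finally show ?thesis unfolding move_def by blast
  qed
  \<comment> \<open>A word is no longer than its code, so \<open>x + y + 2\<close> bounds the
    lengths needed; \<open>code_bound\<close> converts this into a bound on codes, and
    \<open>Suc\<close> makes it strict.\<close>
  define b where "b = (\<lambda>x y. Suc (code_bound K (x + y + 2)))"
  have hs: "\<forall>h\<in>set hs. computable 1 (\<lambda>xs. h (xs ! 0))"
    using computable_rotate1 computable_apply_rule by (auto simp: hs_def rule_fun_def)
  have b: "computable 2 (\<lambda>xs. b (xs ! 0) (xs ! 1))"
    unfolding b_def by (intro computable_intros) auto
  obtain f where f: "recursive 2 f"
    "\<And>x y. ((x, y) \<in> (graph_of hs)\<^sup>* \<Longrightarrow> (x, y) \<in> (graph_of hs \<inter> {..<b x y} \<times> {..<b x y})\<^sup>*)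
      \<Longrightarrow> f [x, y] = (if (x, y) \<in> (graph_of hs)\<^sup>* then 1 else 0)"
    using bounded_reachability[OF hs b] by blast
  have sound: "conjugate_in (traag \<Gamma>) (traag_elem \<Gamma> u) (traag_elem \<Gamma> v)"
    if "(enc u, enc v) \<in> (graph_of hs)\<^sup>*" "u \<in> ?W" "v \<in> ?W" for u v
  proof -
    \<comment> \<open>Every number reachable from \<open>enc u\<close> is itself the code of a word
      over the alphabet, because moves preserve such words.\<close>
    have "\<exists>w\<in>?W. y = enc w \<and> conjugate_in (traag \<Gamma>) (traag_elem \<Gamma> u) (traag_elem \<Gamma> w)"
      if "(enc u, y) \<in> (graph_of hs)\<^sup>*" for y
      using that
    proof (induction rule: rtrancl_induct)
      case base
      then show ?case
        using conjugate_in_refl[OF traag_elem_carrier] \<open>u \<in> ?W\<close> by blast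
    next
      case (step y z)
      then obtain w where w: "w \<in> ?W" "y = enc w"
        "conjugate_in (traag \<Gamma>) (traag_elem \<Gamma> u) (traag_elem \<Gamma> w)" by blast
      with step(2) graph obtain w' where w': "move ?V w w'" "z = enc w'" by blast
      have "conjugate_in (traag \<Gamma>) (traag_elem \<Gamma> u) (traag_elem \<Gamma> w')"
        using conjugate_in_trans[OF traag_elem_carrier[OF \<open>u \<in> ?W\<close>] w(3)]
          move_conjugate[OF w'(1) w(1)] by blast
      then show ?case using w' move_words[OF graph_adj_verts w'(1) w(1)] by blast
    qed
    from this[OF that(1)] obtain w where w: "w \<in> ?W" "enc v = enc w"
      "conjugate_in (traag \<Gamma>) (traag_elem \<Gamma> u) (traag_elem \<Gamma> w)" by blast
    then have "w = v" using inj_map[of v w] that(3) by (simp add: enc_def list_encode_eq)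
    with w show ?thesis by simp
  qed
  have complete: "(enc u, enc v) \<in> (graph_of hs \<inter> {..<b (enc u) (enc v)} \<times> {..<b (enc u) (enc v)})\<^sup>*"
    if uv: "conjugate_in (traag \<Gamma>) (traag_elem \<Gamma> u) (traag_elem \<Gamma> v)" "u \<in> ?W" "v \<in> ?W" for u v
  proof -
    let ?B = "length u + length v + 2"
    have small: "enc w < b (enc u) (enc v)" if "w \<in> ?W" "length w \<le> ?B" for w
    proof -
      have "length u \<le> enc u" "length v \<le> enc v"
        using length_le_list_encode[of "map c u"] length_le_list_encode[of "map c v"]
        by (simp_all add: enc_def)
      then show ?thesis
        unfolding b_def enc_def using that K
        by (intro le_imp_less_Suc list_encode_le_code_bound) (auto simp: enc_def)
    qed
    define N where "N = b (enc u) (enc v)"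
    have "(enc u, enc w) \<in> (graph_of hs \<inter> {..<N} \<times> {..<N})\<^sup>*"
      if "(bmove ?V ?B)\<^sup>*\<^sup>* u w" for w
      using that
    proof (induction rule: rtranclp_induct)
      case (step w w')
      then have "(enc w, enc w') \<in> graph_of hs \<inter> {..<N} \<times> {..<N}"
        using graph small unfolding bmove_def N_def by blast
      with step.IH show ?case by (rule rtrancl_into_rtrancl)
    qed simp
    from this[OF conv_bmoves[OF graph_adj_verts conjugate_conv[OF uv(2,3,1)] uv(2,3)]]
    show ?thesis unfolding N_def .
  qed
  have "f [enc u, enc v] = (if conjugate_in (traag \<Gamma>) (traag_elem \<Gamma> u) (traag_elem \<Gamma> v) then 1 else 0)"
    if uv: "u \<in> ?W" "v \<in> ?W" for u v
  proof -
    have "(enc u, enc v) \<in> (graph_of hs)\<^sup>* \<longleftrightarrow> conjugate_in (traag \<Gamma>) (traag_elem \<Gamma> u) (traag_elem \<Gamma> v)"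
      using sound[OF _ uv] complete[OF _ uv] rtrancl_mono[of "graph_of hs \<inter> _" "graph_of hs"] by blast
    then show ?thesis using f(2)[of "enc u" "enc v"] complete[OF _ uv] by simp
  qed
  then show "\<exists>f. recursive 2 f \<and> (\<forall>u\<in>?W. \<forall>v\<in>?W. f [list_encode (map c u), list_encode (map c v)]
      = (if conjugate_in (traag \<Gamma>) (traag_elem \<Gamma> u) (traag_elem \<Gamma> v) then 1 else 0))"
    using f(1) unfolding enc_def by blast
qed

end

theorem theoremA:
  fixes \<Gamma> :: "'v mixed_graph"
  assumes "finite_mixed_graph \<Gamma>"
  shows "decidable_word_rel (letters (verts \<Gamma>))
           (\<lambda>u v. conjugate_in (traag \<Gamma>) (traag_elem \<Gamma> u) (traag_elem \<Gamma> v))"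
  using assms conjugacy_decidable unfolding finite_mixed_graph_def by blast

end
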